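(* For all integers $n,r$ with $1\le r<n/2$ and all real $\alpha>1$, $$|\kappa(n,r)-e^{-H_r}|\le \frac{\pi e^4\alpha^{2r-n+3/2}}{n^2(\alpha-1)^2}\exp\left\{\sum_{j=1}^r\frac{\alpha^j-2}{j}+E(r,\alpha)\right\}+\frac{4e\,\alpha^{2r-n+2}}{\pi n^2 r(\alpha-1)^3}\exp\left\{-\frac{\alpha(\alpha^r-1)}{2r(\alpha-1)}-H_r\right\},$$ where $$E(r,\alpha)=-\frac2r\,\frac{\alpha^{r+1}}{\alpha-1}\left(\frac{\pi^{-2}}{1+(r\alpha-r)^2}-\alpha^{-r/2}\right)_+ +\min\{2r\log\alpha,\ 2\log(er)\}.$$
   Context: $S_n$ is the symmetric group on $n$ symbols and $k_j(\sigma)$ is the number of cycles of length $j$ in $\sigma\in S_n$. For $1\le r<n$, $$\kappa(n,r)=\frac1{n!}\left|\{\sigma\in S_n:\ k_j(\sigma)=0\text{ for all }1\le j\le r\}\right|.$$ $H_r=\sum_{j=1}^r 1/j$ is the $r$-th harmonic number; $(t)_+=\max\{t,0\}$ for $t\in\mathbb R$; $e$ is Euler's number and $\log$ the natural logarithm. *)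

theory Defs
  imports "HOL-Analysis.Analysis" "HOL-Combinatorics.Orbits"
begin

text \<open>
  The symmetric group \<open>S\<^sub>n\<close> is the set of permutations of \<open>{1..n}\<close>, i.e. functions on \<open>nat\<close>
  that are the identity outside \<open>{1..n}\<close>. A cycle is identified with its underlying orbit;
  fixed points in \<open>{1..n}\<close> thus count as cycles of length 1.
\<close>

definition sym_grp :: "nat \<Rightarrow> (nat \<Rightarrow> nat) set" where
  "sym_grp n = {\<sigma>. \<sigma> permutes {1..n}}"

definition cycle_count :: "nat \<Rightarrow> nat \<Rightarrow> (nat \<Rightarrow> nat) \<Rightarrow> nat" where
  "cycle_count n j \<sigma> = card {C. \<exists>x\<in>{1..n}. C = orbit \<sigma> x \<and> card C = j}"

definition kappa :: "nat \<Rightarrow> nat \<Rightarrow> real" where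
  "kappa n r =
     1 / fact n * real (card {\<sigma> \<in> sym_grp n. \<forall>j\<in>{1..r}. cycle_count n j \<sigma> = 0})"

definition pos_part :: "real \<Rightarrow> real" where
  "pos_part t = max t 0"

definition err_exponent :: "nat \<Rightarrow> real \<Rightarrow> real" where
  "err_exponent r \<alpha> =
     - (2 / real r) * (\<alpha> ^ (r + 1) / (\<alpha> - 1))
       * pos_part (pi powi (-2) / (1 + (real r * \<alpha> - real r)\<^sup>2) - \<alpha> powr (- real r / 2))
     + min (2 * real r * ln \<alpha>) (2 * ln (exp 1 * real r))"

end

theory Submission
  imports Defs "HOL-Complex_Analysis.Complex_Analysis"
begin

text \<open>
  The proportions \<open>kappa n r\<close> have the generating function \<open>h z = f z / (1 - z)\<close> with the entire function
  \<open>f z = exp (- (\<Sum>j=1..r. z ^ j / j))\<close>. Its only singularity is a simple pole at 1, whose residue produces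
  the limit \<open>f 1 = exp (- harm r)\<close>. Hence the error \<open>kappa n r - exp (- harm r)\<close> is the Cauchy integral of
  \<open>h z / z\<^bsup>n+1\<^esup>\<close> over a circle of radius \<open>\<alpha> > 1\<close> (\<open>residue_integral_kappa\<close>). The generating function is
  obtained from a recurrence: classify permutations by the cycle through one chosen point
  (\<open>card_long_cycle_perms_split\<close>).

  Because \<open>h' z = z\<^sup>r f z / (1 - z)\<^sup>2\<close>, each integration by parts gains a factor of order \<open>1/n\<close> at the price of a
  higher pole at 1 and a factor \<open>z\<^sup>r\<close>. Two of them leave \<open>f z (1 + z\<^bsup>r+1\<^esup>) / (1 - z)\<^sup>3\<close>, divided by
  \<open>n (n - r) \<ge> n\<^sup>2 / 2\<close>; this explains \<open>\<alpha>\<^bsup>2r-n\<^esup> / n\<^sup>2\<close> in the bound. What remains is to integrate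
  \<open>|f z| / |1 - z|\<^sup>3\<close> over a half circle \<open>z = \<alpha> e\<^bsup>i t\<^esup>\<close>, \<open>0 \<le> t \<le> pi\<close>.

  On the arc \<open>t \<le> 1/r\<close> only \<open>|1 - z| \<ge> \<alpha> - 1\<close> is used, but all powers \<open>z\<^sup>j\<close> with \<open>j \<le> r\<close> have
  positive real part, so \<open>f\<close> is smaller than \<open>exp (- harm r)\<close> up to a constant (\<open>near_arc_cos_sum\<close>). This is the
  second summand of the bound.

  On the arc \<open>t \<ge> 1/r\<close> the trivial bound for the modulus of \<open>f\<close> is \<open>exp (\<Sum>j=1..r. \<alpha> ^ j / j)\<close>, and
  every gain over it comes from \<open>1 + cos (j t) \<ge> 0\<close>. The indices \<open>j > r/2\<close> carry the large powers of \<open>\<alpha>\<close> and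
  yield the correction in \<open>err_exponent\<close> (\<open>upper_half_cos_sum\<close>). The indices \<open>j \<le> r/2\<close> yield a factor of
  order \<open>t / r\<close> (\<open>lower_half_cos_sum\<close>); its \<open>t\<close> tames the singularity at 1, where \<open>|1 - z|\<close> is of the order of
  \<open>\<alpha> - 1 + t\<close>, and its \<open>1 / r\<close> supplies one of the two powers of \<open>r\<close> contained in \<open>exp (2 harm r)\<close>. The other
  one is covered by the minimum in \<open>err_exponent\<close> (\<open>min_factor_ge\<close>). This is the first summand of the bound.
\<close>

section \<open>Counting permutations by the cycle through one point\<close>

text \<open>
  Arbitrary carriers instead of \<open>{1..n}\<close>: splitting off a cycle leaves a permutation of a subset.
\<close>

definition long_cycle_perms :: "nat \<Rightarrow> 'a set \<Rightarrow> ('a \<Rightarrow> 'a) set" where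
  "long_cycle_perms r A = {\<sigma>. \<sigma> permutes A \<and> (\<forall>x\<in>A. r < card (orbit \<sigma> x))}"

definition cyclic_perms :: "'a set \<Rightarrow> ('a \<Rightarrow> 'a) set" where
  "cyclic_perms C = {\<tau>. \<tau> permutes C \<and> cyclic_on \<tau> C}"

lemma finite_long_cycle_perms: "finite A \<Longrightarrow> finite (long_cycle_perms r A)"
  by (rule finite_subset[OF _ finite_permutations[of A]]) (auto simp: long_cycle_perms_def)

lemma orbit_of_disjoint_comp:
  assumes "\<tau> permutes C" "\<rho> permutes B" "C \<inter> B = {}"
  shows "x \<in> C \<Longrightarrow> orbit (\<tau> \<circ> \<rho>) x = orbit \<tau> x"
    and "x \<in> B \<Longrightarrow> orbit (\<tau> \<circ> \<rho>) x = orbit \<rho> x"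
proof -
  assume x: "x \<in> C"
  show "orbit (\<tau> \<circ> \<rho>) x = orbit \<tau> x"
    using assms x permutes_in_image[OF assms(1)] permutes_not_in[OF assms(2)]
    by (intro orbit_cong0[symmetric, of x C]) (auto simp: disjoint_iff)
next
  assume x: "x \<in> B"
  show "orbit (\<tau> \<circ> \<rho>) x = orbit \<rho> x"
    using assms x permutes_in_image[OF assms(2)] permutes_not_in[OF assms(1)]
    by (intro orbit_cong0[symmetric, of x B]) (auto simp: disjoint_iff intro!: sym[OF permutes_not_in[OF assms(1)]])
qed

text \<open>
  A permutation whose cycle through \<open>a\<close> has support \<open>C\<close> is the product of its
  restrictions to \<open>C\<close> and to the complement, and the two restrictions can be chosen independently.
\<close>

lemma bij_betw_split_off_cycle:
  assumes fin: "finite A" and C: "a \<in> C" "C \<subseteq> A" "r < card C"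
  shows "bij_betw (\<lambda>(\<tau>, \<rho>). \<tau> \<circ> \<rho>) (cyclic_perms C \<times> long_cycle_perms r (A - C))
           {\<sigma> \<in> long_cycle_perms r A. orbit \<sigma> a = C}"
proof (rule bij_betw_byWitness[where f' = "\<lambda>\<sigma>. (perm_restrict \<sigma> C, perm_restrict \<sigma> (A - C))"])
  show "\<forall>p\<in>cyclic_perms C \<times> long_cycle_perms r (A - C).
      (perm_restrict (case p of (\<tau>, \<rho>) \<Rightarrow> \<tau> \<circ> \<rho>) C,
       perm_restrict (case p of (\<tau>, \<rho>) \<Rightarrow> \<tau> \<circ> \<rho>) (A - C)) = p"
  proof (clarify, intro conjI ext)
    fix \<tau> \<rho> x assume "\<tau> \<in> cyclic_perms C" "\<rho> \<in> long_cycle_perms r (A - C)"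
    then have t: "\<tau> permutes C" and p: "\<rho> permutes (A - C)"
      by (auto simp: cyclic_perms_def long_cycle_perms_def)
    show "perm_restrict (\<tau> \<circ> \<rho>) C x = \<tau> x"
      using permutes_not_in[OF t, of x] permutes_not_in[OF p, of x] by (auto simp: perm_restrict_def)
    show "perm_restrict (\<tau> \<circ> \<rho>) (A - C) x = \<rho> x"
      using permutes_not_in[OF t, of "\<rho> x"] permutes_not_in[OF p, of x] permutes_in_image[OF p, of x]
      by (auto simp: perm_restrict_def)
  qed
next
  have cyc: "cyclic_on \<sigma> C" if "\<sigma> permutes A" "orbit \<sigma> a = C" for \<sigma>
    using cyclic_on_orbit[OF that(1) fin, of a] that(2) by simp
  show "\<forall>\<sigma>\<in>{\<sigma> \<in> long_cycle_perms r A. orbit \<sigma> a = C}.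
      (case (perm_restrict \<sigma> C, perm_restrict \<sigma> (A - C)) of (\<tau>, \<rho>) \<Rightarrow> \<tau> \<circ> \<rho>) = \<sigma>"
  proof clarify
    fix \<sigma> assume s: "\<sigma> \<in> long_cycle_perms r A" "C = orbit \<sigma> a"
    then have p: "\<sigma> permutes A" by (simp add: long_cycle_perms_def)
    have c: "cyclic_on \<sigma> C" using cyc p s by simp
    have "perm_restrict \<sigma> C \<circ> perm_restrict \<sigma> (A - C) = \<sigma>"
    proof
      fix x
      have "\<sigma> x \<notin> C" if "x \<notin> C" using cyclic_on_f_in[OF p c, of x] that by blast
      moreover have "\<sigma> x = x" if "x \<notin> A" using permutes_not_in[OF p that] .
      ultimately show "(perm_restrict \<sigma> C \<circ> perm_restrict \<sigma> (A - C)) x = \<sigma> x"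
        by (cases "x \<in> C"; cases "x \<in> A") (simp_all add: perm_restrict_simps)
    qed
    then show "perm_restrict \<sigma> (orbit \<sigma> a) \<circ> perm_restrict \<sigma> (A - orbit \<sigma> a) = \<sigma>"
      using s by simp
  qed
  show "(\<lambda>\<sigma>. (perm_restrict \<sigma> C, perm_restrict \<sigma> (A - C))) `
      {\<sigma> \<in> long_cycle_perms r A. orbit \<sigma> a = C} \<subseteq> cyclic_perms C \<times> long_cycle_perms r (A - C)"
  proof (clarify, intro conjI)
    fix \<sigma> assume s: "\<sigma> \<in> long_cycle_perms r A" "C = orbit \<sigma> a"
    then have p: "\<sigma> permutes A" by (simp add: long_cycle_perms_def)
    have c: "cyclic_on \<sigma> C" using cyc p s by simp
    have pA: "perm_restrict \<sigma> (A - C) permutes (A - C)"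
      by (rule perm_restrict_diff_cyclic[OF p c])
    have "inj_on \<sigma> C" by (rule permutes_inj_on[OF p])
    moreover have "\<sigma> ` C = C"
      using cyclic_on_inI[OF c] by (intro endo_inj_surj finite_cyclic_on[OF c] calculation) blast
    ultimately have "bij_betw \<sigma> C C" by (simp add: bij_betw_def)
    then have "bij_betw (perm_restrict \<sigma> C) C C"
      by (rule bij_betw_cong[THEN iffD1, rotated]) (simp add: perm_restrict_simps)
    then have "perm_restrict \<sigma> C permutes C"
      by (rule bij_imp_permutes) (simp add: perm_restrict_simps)
    moreover have "cyclic_on (perm_restrict \<sigma> C) C"
      using c by (simp add: cyclic_on_perm_restrict)
    ultimately show "perm_restrict \<sigma> (orbit \<sigma> a) \<in> cyclic_perms (orbit \<sigma> a)"
      using s by (simp add: cyclic_perms_def)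
    have "orbit (perm_restrict \<sigma> (A - C)) x = orbit \<sigma> x" if x: "x \<in> A - C" for x
    proof (rule orbit_cong0[of x "A - C"])
      show "perm_restrict \<sigma> (A - C) \<in> A - C \<rightarrow> A - C"
        using permutes_in_image[OF pA] by blast
    qed (use x in \<open>auto simp: perm_restrict_def\<close>)
    then show "perm_restrict \<sigma> (A - orbit \<sigma> a) \<in> long_cycle_perms r (A - orbit \<sigma> a)"
      using s pA by (auto simp: long_cycle_perms_def)
  qed
next
  show "(\<lambda>(\<tau>, \<rho>). \<tau> \<circ> \<rho>) ` (cyclic_perms C \<times> long_cycle_perms r (A - C))
      \<subseteq> {\<sigma> \<in> long_cycle_perms r A. orbit \<sigma> a = C}"
  proof (clarify, intro conjI)
    fix \<tau> \<rho> assume t': "\<tau> \<in> cyclic_perms C" and p': "\<rho> \<in> long_cycle_perms r (A - C)"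
    then have t: "\<tau> permutes C" and p: "\<rho> permutes (A - C)" and cyc: "cyclic_on \<tau> C"
      by (auto simp: cyclic_perms_def long_cycle_perms_def)
    note orb = orbit_of_disjoint_comp[OF t p]
    have C': "orbit (\<tau> \<circ> \<rho>) x = C" if "x \<in> C" for x
      using orb(1)[of x] orbit_cyclic_eq3[OF cyc that] that by auto
    then show "orbit (\<tau> \<circ> \<rho>) a = C" using C by simp
    have "\<tau> \<circ> \<rho> permutes A"
      using permutes_subset[OF t C(2)] permutes_subset[OF p, of A] by (auto intro: permutes_compose)
    moreover have "r < card (orbit (\<tau> \<circ> \<rho>) x)" if "x \<in> A" for x
      using C'[of x] orb(2)[of x] that p' C(3) by (cases "x \<in> C") (auto simp: long_cycle_perms_def)
    ultimately show "\<tau> \<circ> \<rho> \<in> long_cycle_perms r A"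
      by (simp add: long_cycle_perms_def)
  qed
qed

text \<open>
  Classify the permutations by the support \<open>insert a B\<close> of the cycle through a fixed point \<open>a\<close>.
\<close>

lemma card_long_cycle_perms_split:
  assumes fin: "finite A" and a: "a \<in> A"
  shows "card (long_cycle_perms r A) =
    (\<Sum>B | B \<subseteq> A - {a} \<and> r \<le> card B.
       card (cyclic_perms (insert a B)) * card (long_cycle_perms r (A - insert a B)))"
proof -
  let ?I = "{B. B \<subseteq> A - {a} \<and> r \<le> card B}"
  let ?F = "\<lambda>B. {\<sigma> \<in> long_cycle_perms r A. orbit \<sigma> a = insert a B}"
  have finI: "finite ?I" using fin by simp
  have fB: "finite B" "a \<notin> B" "insert a B \<subseteq> A" if "B \<in> ?I" for B
    using that fin a by (auto intro: finite_subset)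
  have split: "long_cycle_perms r A = (\<Union>B\<in>?I. ?F B)"
  proof
    show "long_cycle_perms r A \<subseteq> (\<Union>B\<in>?I. ?F B)"
    proof
      fix \<sigma> assume s: "\<sigma> \<in> long_cycle_perms r A"
      then have p: "\<sigma> permutes A" and r: "r < card (orbit \<sigma> a)"
        using a by (auto simp: long_cycle_perms_def)
      have "a \<in> orbit \<sigma> a"
        using p fin by (intro permutation_self_in_orbit) (auto simp: permutation_permutes)
      moreover have "orbit \<sigma> a \<subseteq> A" by (rule permutes_orbit_subset[OF p a])
      moreover have "card (orbit \<sigma> a - {a}) = card (orbit \<sigma> a) - 1"
        by (rule card_Diff_singleton) fact
      ultimately have "orbit \<sigma> a - {a} \<subseteq> A - {a}" "r \<le> card (orbit \<sigma> a - {a})"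
        using r by (blast, linarith)
      then have B: "orbit \<sigma> a - {a} \<in> ?I" by blast
      have "orbit \<sigma> a = insert a (orbit \<sigma> a - {a})"
        using \<open>a \<in> orbit \<sigma> a\<close> by blast
      then show "\<sigma> \<in> (\<Union>B\<in>?I. ?F B)"
        using s by (intro UN_I[OF B] CollectI conjI)
    qed
  qed blast
  have "card (long_cycle_perms r A) = card (\<Union>B\<in>?I. ?F B)"
    by (rule arg_cong[OF split])
  also have "\<dots> = (\<Sum>B\<in>?I. card (?F B))"
  proof (intro card_UN_disjoint finI ballI impI)
    fix B B' assume "B \<in> ?I" "B' \<in> ?I" "B \<noteq> B'"
    then have "insert a B \<noteq> insert a B'" using fB(2) by blast
    then show "?F B \<inter> ?F B' = {}" by blast
  qed (rule finite_subset[OF _ finite_long_cycle_perms[OF fin, of r]], blast)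
  also have "\<dots> = (\<Sum>B\<in>?I. card (cyclic_perms (insert a B)) * card (long_cycle_perms r (A - insert a B)))"
  proof (intro sum.cong refl)
    fix B assume B: "B \<in> ?I"
    have "r < card (insert a B)" using fB[OF B] B by simp
    from bij_betw_same_card[OF bij_betw_split_off_cycle[OF fin insertI1 fB(3)[OF B] this]]
    show "card (?F B) = card (cyclic_perms (insert a B)) * card (long_cycle_perms r (A - insert a B))"
      by (simp only: card_cartesian_product)
  qed
  finally show ?thesis .
qed

lemma sum_subsets_by_card:
  fixes g :: "nat \<Rightarrow> 'b :: semiring_1"
  assumes "finite S"
  shows "(\<Sum>B | B \<subseteq> S \<and> r \<le> card B. g (card B)) =
    (\<Sum>k = r..card S. of_nat (card S choose k) * g k)"
proof -
  let ?I = "{B. B \<subseteq> S \<and> r \<le> card B}"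
  have "(\<Sum>k = r..card S. \<Sum>B | B \<in> ?I \<and> card B = k. g (card B)) = (\<Sum>B\<in>?I. g (card B))"
    using assms by (intro sum.group) (auto intro: card_mono)
  moreover have "(\<Sum>B | B \<in> ?I \<and> card B = k. g (card B)) = of_nat (card S choose k) * g k"
    if "k \<in> {r..card S}" for k
  proof -
    have "{B. B \<in> ?I \<and> card B = k} = {B. B \<subseteq> S \<and> card B = k}"
      using that by auto
    then have "(\<Sum>B | B \<in> ?I \<and> card B = k. g (card B)) = (\<Sum>B | B \<subseteq> S \<and> card B = k. g k)"
      by (intro sum.cong) auto
    then show ?thesis using n_subsets[OF assms, of k] by simp
  qed
  ultimately show ?thesis by simp
qed

lemma long_cycle_perms_0:
  assumes "finite A"
  shows "long_cycle_perms 0 A = {\<sigma>. \<sigma> permutes A}"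
proof -
  have "0 < card (orbit \<sigma> x)" if "\<sigma> permutes A" "x \<in> A" for \<sigma> x
    using finite_subset[OF permutes_orbit_subset[OF that] assms] orbit_nonempty[of \<sigma> x]
    by (simp add: card_gt_0_iff)
  then show ?thesis by (auto simp: long_cycle_perms_def)
qed

text \<open>
  No enumeration of cycles is needed. With \<open>r = 0\<close> the classification counts all
  \<open>(m + 1)!\<close> permutations of a set with \<open>m + 1\<close> elements; by induction each of the \<open>m\<close> possible
  lengths of the cycle through \<open>a\<close> below the maximal one accounts for \<open>m!\<close> of them, so exactly
  \<open>m!\<close> permutations are left for the single cycle of full length.
\<close>

lemma card_cyclic_perms:
  assumes "finite C" "C \<noteq> {}"
  shows "card (cyclic_perms C) = fact (card C - 1)"
  using assms
proof (induction C rule: finite_psubset_induct)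
  case (psubset A)
  then obtain a where a: "a \<in> A" by blast
  let ?S = "A - {a}"
  define m where "m = card ?S"
  have fS: "finite ?S" and cA: "card A = Suc m"
    using psubset(1) a card_Suc_Diff1[OF psubset(1) a] by (simp_all add: m_def)
  have eq: "card (cyclic_perms (insert a B)) * card (long_cycle_perms 0 (A - insert a B)) =
      fact (card B) * fact (m - card B)" if B: "B \<subseteq> ?S" "B \<noteq> ?S" for B
  proof -
    have fB: "finite B" "a \<notin> B" using B fS finite_subset by auto
    have "card (cyclic_perms (insert a B)) = fact (card B)"
      using psubset.IH[of "insert a B"] B a fB by auto
    moreover have "A - insert a B = ?S - B" by auto
    moreover have "card (?S - B) = m - card B"
      using B fB by (simp add: card_Diff_subset m_def)
    ultimately show ?thesis
      using card_permutations[of "A - insert a B" "m - card B"] fS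
      by (simp add: long_cycle_perms_0)
  qed
  \<comment> \<open>The trivially true cardinality condition matches the index set of the classification at \<open>r = 0\<close>.\<close>
  let ?P = "{B. B \<subseteq> ?S \<and> 0 \<le> card B}"
  have P: "?P = insert ?S (?P - {?S})" "finite (?P - {?S})" using fS by auto
  let ?g = "\<lambda>k. fact k * fact (m - k) :: nat"
  have "fact (Suc m) = card (long_cycle_perms 0 A)"
    using card_permutations[OF cA] psubset by (simp add: long_cycle_perms_0)
  also have "\<dots> = (\<Sum>B\<in>?P. card (cyclic_perms (insert a B)) * card (long_cycle_perms 0 (A - insert a B)))"
    by (rule card_long_cycle_perms_split) (use psubset a in auto)
  also have "\<dots> = card (cyclic_perms A) + (\<Sum>B\<in>?P - {?S}. ?g (card B))"
    using a by (subst P(1), subst sum.insert[OF P(2)])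
      (auto simp: eq insert_absorb long_cycle_perms_0 insert_Diff intro!: sum.cong)
  also have "(\<Sum>B\<in>?P - {?S}. ?g (card B)) = (\<Sum>B\<in>?P. ?g (card B)) - fact m"
    by (subst (2) P(1), subst sum.insert[OF P(2)]) (auto simp: m_def)
  also have "(\<Sum>B\<in>?P. ?g (card B)) = (\<Sum>k = 0..m. (m choose k) * ?g k)"
    using sum_subsets_by_card[OF fS, where r = 0 and g = ?g] by (simp add: m_def)
  also have "\<dots> = (\<Sum>k = 0..m. fact m)"
    using binomial_fact_lemma[of _ m] by (intro sum.cong) (auto simp: algebra_simps)
  finally have "fact (Suc m) = card (cyclic_perms A) + ((m + 1) * fact m - fact m)"
    by (simp only: sum_constant card_atLeastAtMost of_nat_id diff_zero Suc_eq_plus1)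
  moreover have "fact (Suc m) = fact m + ((m + 1) * fact m - fact m :: nat)" by simp
  ultimately have "card (cyclic_perms A) = fact m" by (simp only: add_right_cancel)
  then show ?case by (simp only: cA diff_Suc_1)
qed

text \<open>
  The classification by the cycle through one point becomes, after division by the factorial,
  a recurrence for the proportion \<open>q\<close> of long-cycle permutations: \<open>(m choose k) k! (m - k)! = m!\<close>, so every
  admissible cycle length \<open>k + 1\<close> contributes equally. Any sequence with this recurrence, in any field
  of characteristic zero, therefore counts them.
\<close>

lemma card_long_cycle_perms:
  fixes q :: "nat \<Rightarrow> 'b :: field_char_0"
  assumes q0: "q 0 = 1"
    and q: "\<And>n. of_nat (Suc n) * q (Suc n) = (\<Sum>k = r..n. q (n - k))"
    and fin: "finite A"
  shows "of_nat (card (long_cycle_perms r A)) = fact (card A) * q (card A)"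
  using fin
proof (induction A rule: finite_psubset_induct)
  case (psubset A)
  show ?case
  proof (cases "A = {}")
    case True
    then have "long_cycle_perms r A = {id}" by (auto simp: long_cycle_perms_def)
    then show ?thesis using True q0 by simp
  next
    case False
    then obtain a where a: "a \<in> A" by blast
    let ?S = "A - {a}"
    define m where "m = card ?S"
    have fS: "finite ?S" and cA: "card A = Suc m"
      using psubset(1) a card_Suc_Diff1[OF psubset(1) a] by (simp_all add: m_def)
    let ?g = "\<lambda>k. fact k * (fact (m - k) * q (m - k))"
    have eq: "of_nat (card (cyclic_perms (insert a B)) * card (long_cycle_perms r (A - insert a B))) =
        ?g (card B)" if B: "B \<subseteq> ?S" for B
    proof -
      have fB: "finite B" "a \<notin> B" using B fS finite_subset by auto
      have "card (cyclic_perms (insert a B)) = fact (card B)"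
        using card_cyclic_perms[of "insert a B"] fB by simp
      moreover have "A - insert a B = ?S - B" by auto
      moreover have "card (?S - B) = m - card B"
        using B fB by (simp add: card_Diff_subset m_def)
      moreover have "A - insert a B \<subset> A" using a by auto
      ultimately show ?thesis using psubset.IH[of "A - insert a B"] by simp
    qed
    have "of_nat (card (long_cycle_perms r A)) = (\<Sum>B | B \<subseteq> ?S \<and> r \<le> card B. ?g (card B))"
      unfolding card_long_cycle_perms_split[OF psubset(1) a, of r] of_nat_sum
      by (intro sum.cong refl) (use eq in auto)
    also have "\<dots> = (\<Sum>k = r..m. of_nat (m choose k) * ?g k)"
      using sum_subsets_by_card[OF fS, where r = r and g = ?g] by (simp add: m_def)
    also have "\<dots> = (\<Sum>k = r..m. fact m * q (m - k))"
    proof (intro sum.cong refl)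
      fix k assume "k \<in> {r..m}"
      then have "of_nat (fact k * fact (m - k) * (m choose k)) = (fact m :: 'b)"
        by (subst binomial_fact_lemma) auto
      then have "fact m = of_nat (m choose k) * (fact k * fact (m - k) :: 'b)"
        by (simp add: mult.commute)
      then show "of_nat (m choose k) * ?g k = fact m * q (m - k)"
        by (simp only: mult.assoc)
    qed
    also have "\<dots> = fact m * (of_nat (Suc m) * q (Suc m))"
      by (simp add: sum_distrib_left q del: of_nat_Suc)
    finally show ?thesis by (simp add: cA algebra_simps)
  qed
qed

lemma kappa_eq_long_cycle_perms:
  "kappa n r = real (card (long_cycle_perms r {1..n})) / fact n"
proof -
  have "(\<forall>j\<in>{1..r}. cycle_count n j \<sigma> = 0) \<longleftrightarrow> (\<forall>x\<in>{1..n}. r < card (orbit \<sigma> x))"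
    if p: "\<sigma> permutes {1..n}" for \<sigma>
  proof -
    have pos: "0 < card (orbit \<sigma> x)" if "x \<in> {1..n}" for x
      using long_cycle_perms_0[of "{1..n}"] p that unfolding long_cycle_perms_def by blast
    have "cycle_count n j \<sigma> = 0 \<longleftrightarrow> (\<forall>x\<in>{1..n}. card (orbit \<sigma> x) \<noteq> j)" for j
    proof -
      have "finite {C. \<exists>x\<in>{1..n}. C = orbit \<sigma> x \<and> card C = j}"
        by (rule finite_subset[of _ "orbit \<sigma> ` {1..n}"]) auto
      then show ?thesis by (auto simp: cycle_count_def)
    qed
    then have "(\<forall>j\<in>{1..r}. cycle_count n j \<sigma> = 0) \<longleftrightarrow> (\<forall>x\<in>{1..n}. card (orbit \<sigma> x) \<notin> {1..r})"
      by blast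
    also have "\<dots> \<longleftrightarrow> (\<forall>x\<in>{1..n}. r < card (orbit \<sigma> x))"
      using pos by (intro ball_cong refl) (metis One_nat_def Suc_leI atLeastAtMost_iff leD leI)
    finally show ?thesis .
  qed
  then have "{\<sigma> \<in> sym_grp n. \<forall>j\<in>{1..r}. cycle_count n j \<sigma> = 0} = long_cycle_perms r {1..n}"
    unfolding sym_grp_def long_cycle_perms_def by blast
  then show ?thesis by (simp only: kappa_def times_divide_eq_left mult_1)
qed

section \<open>The generating function and its Cauchy integral\<close>

text \<open>
  By the exponential formula \<open>cycle_kernel r z / (1 - z)\<close> is the generating function of \<open>kappa n r\<close> in \<open>n\<close>:
  it is the exponential of \<open>\<Sum> z\<^sup>j / j\<close> over \<open>j > r\<close>.
\<close>

definition cycle_kernel :: "nat \<Rightarrow> complex \<Rightarrow> complex" where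
  "cycle_kernel r z = exp (- (\<Sum>j=1..r. z ^ j / of_nat j))"

lemma has_derivative_cycle_kernel:
  "(cycle_kernel r has_field_derivative - (\<Sum>j<r. z ^ j) * cycle_kernel r z) (at z)"
proof -
  have "((\<lambda>z. - (\<Sum>j=1..r. z ^ j / of_nat j)) has_field_derivative
      - (\<Sum>j=1..r. of_nat j * z ^ (j - Suc 0) / of_nat j)) (at z)"
    by (auto intro!: derivative_eq_intros)
  moreover have "(\<Sum>j=1..r. of_nat j * z ^ (j - Suc 0) / of_nat j) = (\<Sum>j<r. z ^ j)"
    by (rule sum.reindex_bij_witness[of _ Suc "\<lambda>j. j - 1"]) auto
  ultimately show ?thesis
    unfolding cycle_kernel_def by (auto intro!: derivative_eq_intros)
qed

text \<open>
  The pole of order one becomes a pole of order two, but a factor \<open>z\<^sup>r\<close> appears: logarithmic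
  differentiation gives \<open>\<Sum> z\<^bsup>j-1\<^esup>\<close> over \<open>j > r\<close>, which is \<open>z\<^sup>r / (1 - z)\<close>.
\<close>

lemma has_derivative_kernel_quotient:
  assumes "z \<noteq> 1"
  shows "((\<lambda>z. cycle_kernel r z / (1 - z)) has_field_derivative
           z ^ r * cycle_kernel r z / (1 - z) ^ 2) (at z)"
proof -
  have g: "(1 - z) * (\<Sum>j<r. z ^ j) = 1 - z ^ r"
    by (simp add: one_diff_power_eq)
  have "((\<lambda>z. cycle_kernel r z / (1 - z)) has_field_derivative
      (- (\<Sum>j<r. z ^ j) * cycle_kernel r z * (1 - z) - cycle_kernel r z * (- 1)) / ((1 - z) * (1 - z))) (at z)"
    using assms by (auto intro!: derivative_eq_intros has_derivative_cycle_kernel)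
  also have "- (\<Sum>j<r. z ^ j) * cycle_kernel r z * (1 - z) - cycle_kernel r z * (- 1) =
      (1 - (1 - z) * (\<Sum>j<r. z ^ j)) * cycle_kernel r z"
    by (simp add: algebra_simps)
  finally show ?thesis by (simp add: g power2_eq_square)
qed

text \<open>
  Comparing coefficients in \<open>(1 - z) h' = z\<^sup>r h\<close> gives a first-order recurrence that telescopes to the
  recurrence satisfied by the proportion of long-cycle permutations.
\<close>

lemma kernel_quotient_coeff_rec:
  assumes "(\<lambda>z. cycle_kernel r z / (1 - z)) has_fps_expansion H"
  shows "of_nat (Suc n) * fps_nth H (Suc n) = (\<Sum>k=r..n. fps_nth H (n - k))"
proof -
  let ?h = "\<lambda>z. cycle_kernel r z / (1 - z)"
  have "(\<lambda>z. (1 - z) * deriv ?h z) has_fps_expansion (1 - fps_X) * fps_deriv H"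
    by (intro fps_expansion_intros assms)
  moreover have "(\<lambda>z. z ^ r * ?h z) has_fps_expansion fps_X ^ r * H"
    by (intro fps_expansion_intros assms)
  moreover have "eventually (\<lambda>z. (1 - z) * deriv ?h z = z ^ r * ?h z) (nhds 0)"
  proof -
    have "eventually (\<lambda>z :: complex. z \<in> - {1}) (nhds 0)"
      by (intro eventually_nhds_in_open) auto
    then show ?thesis
    proof eventually_elim
      case (elim z)
      then have "deriv ?h z = z ^ r * cycle_kernel r z / (1 - z) ^ 2"
        by (intro DERIV_imp_deriv has_derivative_kernel_quotient) auto
      then show ?case using elim by (simp add: power2_eq_square)
    qed
  qed
  ultimately have eq: "(1 - fps_X) * fps_deriv H = fps_X ^ r * H"
    using has_fps_expansion_cong[of "\<lambda>z. (1 - z) * deriv ?h z" "\<lambda>z. z ^ r * ?h z", OF _ refl]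
    by (blast intro: fps_expansion_unique_complex)
  have rec: "of_nat (Suc n) * fps_nth H (Suc n) =
      of_nat n * fps_nth H n + (if n < r then 0 else fps_nth H (n - r))" for n
  proof -
    have "fps_nth ((1 - fps_X) * fps_deriv H) n = of_nat (Suc n) * fps_nth H (Suc n) - of_nat n * fps_nth H n"
      by (cases n) (simp_all add: algebra_simps)
    moreover have "fps_nth (fps_X ^ r * H) n = (if n < r then 0 else fps_nth H (n - r))"
      by (rule fps_X_power_mult_nth)
    ultimately show ?thesis unfolding eq by (metis add.commute diff_add_cancel)
  qed
  show ?thesis
  proof (induction n)
    case 0
    then show ?case using rec[of 0] by (cases r) auto
  next
    case (Suc n)
    have "(\<Sum>k=r..Suc n. fps_nth H (Suc n - k)) =
        (if Suc n < r then 0 else fps_nth H (Suc n - r)) + (\<Sum>k=Suc r..Suc n. fps_nth H (Suc n - k))"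
      by (simp add: sum.atLeast_Suc_atMost)
    also have "(\<Sum>k=Suc r..Suc n. fps_nth H (Suc n - k)) = (\<Sum>k=r..n. fps_nth H (n - k))"
      by (subst sum.shift_bounds_cl_Suc_ivl) simp
    finally show ?case using rec[of "Suc n"] Suc by simp
  qed
qed

lemma kappa_eq_coeff:
  assumes H: "(\<lambda>z. cycle_kernel r z / (1 - z)) has_fps_expansion H"
  shows "complex_of_real (kappa n r) = fps_nth H n"
proof -
  have "fps_nth H 0 = 1"
    using has_fps_expansion_imp_0_eq_fps_nth_0[OF H] by (simp add: cycle_kernel_def power_0_left)
  from card_long_cycle_perms[OF this kernel_quotient_coeff_rec[OF H], of "{1..n}"]
  show ?thesis by (simp add: kappa_eq_long_cycle_perms)
qed

lemma cycle_kernel_1: "cycle_kernel r 1 = of_real (exp (- harm r))"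
  by (simp add: cycle_kernel_def harm_def exp_of_real[symmetric] inverse_eq_divide)

lemma holomorphic_cycle_kernel [holomorphic_intros]:
  "f holomorphic_on A \<Longrightarrow> (\<lambda>z. cycle_kernel r (f z)) holomorphic_on A"
  unfolding cycle_kernel_def by (intro holomorphic_intros) auto

text \<open>
  The residue at 0 is the coefficient \<open>kappa n r\<close>. The circle of radius \<open>\<alpha> > 1\<close> also encloses the simple
  pole at 1, and its residue is minus the limit \<open>exp (- harm r)\<close>; so the integral is the error itself.
\<close>

lemma residue_integral_kappa:
  assumes "\<alpha> > 1"
  shows "contour_integral (circlepath 0 \<alpha>) (\<lambda>z. cycle_kernel r z / (1 - z) / z ^ Suc n) =
    2 * pi * \<i> * of_real (kappa n r - exp (- harm r))"
proof -
  let ?h = "\<lambda>z. cycle_kernel r z / (1 - z)"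
  let ?g = "\<lambda>z. ?h z / z ^ Suc n"
  have "?h holomorphic_on ball 0 1" by (auto intro!: holomorphic_intros)
  then have H: "?h has_fps_expansion fps_expansion ?h 0"
    by (intro has_fps_expansion_fps_expansion[of "ball 0 1"]) auto
  have res0: "residue ?g 0 = of_real (kappa n r)"
    using residue_fps_expansion_over_power_at_0[OF H, of n] kappa_eq_coeff[OF H] by simp
  have "residue (\<lambda>z. (- cycle_kernel r z / z ^ Suc n) / (z - 1)) 1 = - cycle_kernel r 1 / 1 ^ Suc n"
    by (rule residue_simple[of "- {0}"]) (auto intro!: holomorphic_intros)
  moreover have "(\<lambda>z. (- cycle_kernel r z / z ^ Suc n) / (z - 1)) = ?g"
  proof
    fix z :: complex
    have "z - 1 = - (1 - z)" by simp
    then show "(- cycle_kernel r z / z ^ Suc n) / (z - 1) = ?g z"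
      by (simp only: minus_divide_left [symmetric] minus_divide_right [symmetric] minus_minus divide_divide_eq_left mult.commute)
  qed
  ultimately have res1: "residue ?g 1 = - of_real (exp (- harm r))"
    by (simp add: cycle_kernel_1)
  have "contour_integral (circlepath 0 \<alpha>) ?g =
      2 * pi * \<i> * (\<Sum>p\<in>{0,1}. winding_number (circlepath 0 \<alpha>) p * residue ?g p)"
    by (rule Residue_theorem[of UNIV]) (use assms in \<open>auto intro!: holomorphic_intros\<close>)
  also have "(\<Sum>p\<in>{0,1}. winding_number (circlepath 0 \<alpha>) p * residue ?g p) =
      of_real (kappa n r - exp (- harm r))"
  proof -
    have "(\<Sum>p\<in>{0, 1 :: complex}. u p) = u 0 + u 1" for u :: "complex \<Rightarrow> complex" by simp
    moreover have "winding_number (circlepath 0 \<alpha>) 0 = 1" "winding_number (circlepath 0 \<alpha>) 1 = 1"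
      using assms by (simp_all add: winding_number_circlepath)
    ultimately show ?thesis
      by (simp only: res0 res1 mult_1 of_real_diff add_uminus_conv_diff)
  qed
  finally show ?thesis .
qed

lemma has_derivative_over_power:
  fixes z :: complex
  assumes "(g has_field_derivative g') (at z)" "z \<noteq> 0"
  shows "((\<lambda>z. g z / z ^ m) has_field_derivative g' / z ^ m - of_nat m * (g z / z ^ Suc m)) (at z)"
proof -
  have "((\<lambda>z. g z / z ^ m) has_field_derivative
      (g' * z ^ m - g z * (of_nat m * z ^ (m - Suc 0))) / (z ^ m * z ^ m)) (at z)"
    using assms by (auto intro!: derivative_eq_intros)
  also have "(g' * z ^ m - g z * (of_nat m * z ^ (m - Suc 0))) / (z ^ m * z ^ m) =
      g' / z ^ m - of_nat m * (g z / z ^ Suc m)"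
    using assms(2) by (cases m) (simp_all add: diff_divide_distrib)
  finally show ?thesis .
qed

lemma has_derivative_kernel_quotient2:
  assumes "z \<noteq> 1"
  shows "((\<lambda>z. cycle_kernel r z / (1 - z) ^ 2) has_field_derivative
           cycle_kernel r z * (1 + z ^ r) / (1 - z) ^ 3) (at z)"
proof -
  have u: "1 - z \<noteq> 0" using assms by simp
  have "((\<lambda>z. cycle_kernel r z / (1 - z) / (1 - z)) has_field_derivative
      (z ^ r * cycle_kernel r z / (1 - z) ^ 2 * (1 - z) - cycle_kernel r z / (1 - z) * (- 1)) / ((1 - z) * (1 - z))) (at z)"
    using u by (intro DERIV_divide has_derivative_kernel_quotient[OF assms]) (auto intro!: derivative_eq_intros)
  also have "(z ^ r * cycle_kernel r z / (1 - z) ^ 2 * (1 - z) - cycle_kernel r z / (1 - z) * (- 1)) / ((1 - z) * (1 - z))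
      = cycle_kernel r z * (1 + z ^ r) / (1 - z) ^ 3"
    using u by (simp add: power2_eq_square power3_eq_cube divide_simps) (simp add: algebra_simps)
  finally show ?thesis by (simp add: power2_eq_square)
qed

text \<open>
  Two integrations by parts, each trading one power of \<open>n\<close> for a power of \<open>1 / (1 - z)\<close>. They are
  combined in a single primitive \<open>(n - r) h / z\<^sup>n + k / z\<^bsup>n-r-1\<^esup>\<close> with \<open>k = cycle_kernel r z / (1 - z)\<^sup>2\<close>. In the second
  step a factor \<open>z\<close> is moved over to \<open>k\<close>, so that the divisor is \<open>n - r\<close> and not \<open>n - r - 1\<close>.
\<close>

lemma kappa_contour_integral:
  assumes "\<alpha> > 1" "r < n"
  shows "of_nat (n * (n - r)) * (2 * pi * \<i> * of_real (kappa n r - exp (- harm r))) =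
    contour_integral (circlepath 0 \<alpha>)
      (\<lambda>z. cycle_kernel r z * (1 + z ^ Suc r) / (1 - z) ^ 3 / z ^ (n - r))"
proof -
  define d where "d = n - r - 1"
  have n: "n = r + Suc d" and nr: "n - r = Suc d" using assms by (simp_all add: d_def)
  let ?f = "cycle_kernel r"
  let ?h = "\<lambda>z. ?f z / (1 - z)"
  let ?k = "\<lambda>z. ?f z / (1 - z) ^ 2"
  let ?W = "\<lambda>z. ?f z * (1 + z ^ Suc r) / (1 - z) ^ 3 / z ^ Suc d"
  let ?G = "\<lambda>z. of_nat (Suc d) * (?h z / z ^ n) + ?k z / z ^ d"
  let ?S = "- {0, 1 :: complex}"
  have "(?G has_field_derivative ?W z - of_nat (n * Suc d) * (?h z / z ^ Suc n)) (at z within ?S)"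
    if z: "z \<in> ?S" for z
  proof -
    have z': "z \<noteq> 0" "z \<noteq> 1" "1 - z \<noteq> 0" using z by auto
    have "(?G has_field_derivative
       of_nat (Suc d) * (z ^ r * ?f z / (1 - z) ^ 2 / z ^ n - of_nat n * (?h z / z ^ Suc n)) +
       (?f z * (1 + z ^ r) / (1 - z) ^ 3 / z ^ d - of_nat d * (?k z / z ^ Suc d))) (at z)"
      by (intro DERIV_add DERIV_cmult has_derivative_over_power
           has_derivative_kernel_quotient has_derivative_kernel_quotient2 z')
    moreover have "z ^ r * ?f z / (1 - z) ^ 2 / z ^ n = ?k z / z ^ Suc d"
      using z'(1) by (simp add: n power_add)
    moreover have "?f z * (1 + z ^ r) / (1 - z) ^ 3 / z ^ d + ?k z / z ^ Suc d = ?W z"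
    proof -
      have "?f z * (1 + z ^ r) / (1 - z) ^ 3 / z ^ d = ?f z * (z * (1 + z ^ r)) / (1 - z) ^ 3 / z ^ Suc d"
        using z'(1) by simp
      moreover have "?k z / z ^ Suc d = ?f z * (1 - z) / (1 - z) ^ 3 / z ^ Suc d"
        using z'(3) by (simp add: power2_eq_square power3_eq_cube)
      ultimately have "?f z * (1 + z ^ r) / (1 - z) ^ 3 / z ^ d + ?k z / z ^ Suc d =
          (?f z * (z * (1 + z ^ r)) + ?f z * (1 - z)) / (1 - z) ^ 3 / z ^ Suc d"
        by (simp only: add_divide_distrib)
      also have "?f z * (z * (1 + z ^ r)) + ?f z * (1 - z) = ?f z * (1 + z ^ Suc r)"
        by (simp add: algebra_simps)
      finally show ?thesis .
    qed
    moreover have "of_nat (Suc d) * (K - of_nat n * c) + (b - of_nat d * K) = (b + K) - of_nat (n * Suc d) * c"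
      for K b c :: complex
      by (simp add: algebra_simps)
    ultimately have "(?G has_field_derivative ?W z - of_nat (n * Suc d) * (?h z / z ^ Suc n)) (at z)"
      by (simp only:)
    then show ?thesis by (rule has_field_derivative_at_within)
  qed
  then have "((\<lambda>z. ?W z - of_nat (n * Suc d) * (?h z / z ^ Suc n)) has_contour_integral 0) (circlepath 0 \<alpha>)"
    by (rule Cauchy_theorem_primitive) (use assms(1) in auto)
  then have "contour_integral (circlepath 0 \<alpha>) (\<lambda>z. ?W z - of_nat (n * Suc d) * (?h z / z ^ Suc n)) = 0"
    by (rule contour_integral_unique)
  moreover have W: "?W contour_integrable_on circlepath 0 \<alpha>"
    and h: "(\<lambda>z. ?h z / z ^ Suc n) contour_integrable_on circlepath 0 \<alpha>"
    using assms(1) by (intro contour_integrable_holomorphic_simple[of _ ?S]; (auto intro!: holomorphic_intros open_Compl)[1])+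
  ultimately have "contour_integral (circlepath 0 \<alpha>) ?W =
      of_nat (n * Suc d) * contour_integral (circlepath 0 \<alpha>) (\<lambda>z. ?h z / z ^ Suc n)"
    by (simp only: contour_integral_diff[OF W contour_integrable_lmul[OF h]] contour_integral_lmul[OF h] right_minus_eq)
  then show ?thesis
    by (simp only: residue_integral_kappa[OF assms(1)] nr)
qed

section \<open>Reduction to a real integral over a half circle\<close>

lemma Re_power_polar: "Re ((of_real a * cis t) ^ j) = a ^ j * cos (real j * t)"
proof -
  have "(of_real a * cis t) ^ j = of_real (a ^ j) * cis (real j * t)"
    using Complex.DeMoivre[of t j] by (simp add: power_mult_distrib)
  moreover have "Re (of_real x * cis y) = x * cos y" for x y by simp
  ultimately show ?thesis by (simp only:)
qed

text \<open>
  The modulus of \<open>cycle_kernel r z / (1 - z)\<^sup>3\<close> at \<open>z = \<alpha> e\<^bsup>i t\<^esup>\<close>, written with real functions only so that its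
  symmetry in \<open>t\<close> is visible.
\<close>

definition arc_density :: "nat \<Rightarrow> real \<Rightarrow> real \<Rightarrow> real" where
  "arc_density r \<alpha> t = exp (- (\<Sum>j=1..r. \<alpha> ^ j * cos (real j * t) / real j)) / sqrt (1 - 2 * \<alpha> * cos t + \<alpha>\<^sup>2) ^ 3"

lemma norm_cycle_kernel_cis:
  "norm (cycle_kernel r (of_real \<alpha> * cis t)) = exp (- (\<Sum>j=1..r. \<alpha> ^ j * cos (real j * t) / real j))"
proof -
  have "Re (- (\<Sum>j=1..r. (of_real \<alpha> * cis t) ^ j / of_nat j)) = - (\<Sum>j=1..r. \<alpha> ^ j * cos (real j * t) / real j)"
    by (simp only: uminus_complex.sel Re_sum Re_divide_of_nat Re_power_polar)
  then show ?thesis by (simp only: cycle_kernel_def norm_exp_eq_Re)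
qed

lemma norm_one_minus_cis: "norm (1 - of_real \<alpha> * cis t) = sqrt (1 - 2 * \<alpha> * cos t + \<alpha>\<^sup>2)"
proof -
  have "(1 - \<alpha> * c)\<^sup>2 + (\<alpha> * s)\<^sup>2 = 1 - 2 * \<alpha> * c + \<alpha>\<^sup>2 * (s\<^sup>2 + c\<^sup>2)" for c s :: real
    by (simp add: power2_eq_square algebra_simps)
  from this[of "cos t" "sin t"] show ?thesis by (simp add: cmod_def)
qed

lemma dist_from_one_pos:
  assumes "\<alpha> > (1 :: real)"
  shows "1 - 2 * \<alpha> * cos t + \<alpha>\<^sup>2 > 0"
proof -
  have "\<alpha> * cos t \<le> \<alpha> * 1" using assms by (intro mult_left_mono) auto
  moreover have "(\<alpha> - 1)\<^sup>2 > 0" using assms by simp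
  moreover have "(\<alpha> - 1)\<^sup>2 = 1 - 2 * \<alpha> + \<alpha>\<^sup>2" by (simp add: power2_eq_square algebra_simps)
  ultimately show ?thesis by linarith
qed

lemma continuous_on_arc_density: "\<alpha> > 1 \<Longrightarrow> continuous_on A (arc_density r \<alpha>)"
  unfolding arc_density_def using dist_from_one_pos[of \<alpha>]
  by (auto intro!: continuous_intros simp: less_imp_neq[symmetric])

lemma arc_density_reflect: "arc_density r \<alpha> (2 * pi - t) = arc_density r \<alpha> t"
proof -
  have "cos (real j * (2 * pi - t)) = cos (real j * t)" for j
  proof -
    have "cos (real j * (2 * pi - t)) = cos (2 * real j * pi - real j * t)"
      by (simp add: algebra_simps)
    also have "\<dots> = cos (real j * t)"
      by (simp only: cos_diff cos_2npi sin_2npi mult_1 mult_zero_left add_0_right)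
    finally show ?thesis .
  qed
  from this this[of 1] show ?thesis by (simp add: arc_density_def)
qed

lemma integral_arc_density_symmetric:
  assumes "\<alpha> > 1"
  shows "integral {0..2 * pi} (arc_density r \<alpha>) = 2 * integral {0..pi} (arc_density r \<alpha>)"
proof -
  let ?w = "arc_density r \<alpha>"
  have int: "?w integrable_on {a..b}" for a b
    using continuous_on_arc_density[OF assms] by (rule integrable_continuous_real)
  have "(?w has_integral integral {0..pi} ?w) (cbox 0 pi)"
    using int by (simp add: has_integral_integral)
  from has_integral_affinity[OF this, of "- 1" "2 * pi"]
  have "((\<lambda>t. ?w (2 * pi - t)) has_integral integral {0..pi} ?w) ((\<lambda>x. 2 * pi - x) ` {0..pi})"
    by simp
  also have "(\<lambda>x. 2 * pi - x) ` {0..pi} = {pi..2 * pi}"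
    by (simp add: image_diff_atLeastAtMost)
  finally have "integral {pi..2 * pi} ?w = integral {0..pi} ?w"
    by (simp add: arc_density_reflect integral_unique)
  moreover have "integral {0..pi} ?w + integral {pi..2 * pi} ?w = integral {0..2 * pi} ?w"
    by (intro Henstock_Kurzweil_Integration.integral_combine int) auto
  ultimately show ?thesis by simp
qed

text \<open>
  The constant 4 collects a factor 2 from \<open>1 + \<alpha>\<^bsup>r+1\<^esup> \<le> 2 \<alpha>\<^bsup>r+1\<^esup>\<close> and another from \<open>n (n - r) \<ge> n\<^sup>2 / 2\<close>; the
  latter is where \<open>2 r < n\<close> enters. The two halves of the circle contribute equally.
\<close>

lemma kappa_bound_by_arc_integral:
  assumes \<alpha>: "\<alpha> > 1" and n: "real r < real n / 2"
  shows "\<bar>kappa n r - exp (- harm r)\<bar> \<le>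
    4 * \<alpha> powr (2 * real r - real n + 2) / (pi * (real n)\<^sup>2) * integral {0..pi} (arc_density r \<alpha>)"
proof -
  let ?W = "\<lambda>z. cycle_kernel r z * (1 + z ^ Suc r) / (1 - z) ^ 3 / z ^ (n - r)"
  let ?w = "arc_density r \<alpha>"
  let ?c = "2 * \<alpha> powr (2 * real r - real n + 2)"
  have rn: "r < n" "0 < n" using n by linarith+
  have cont: "continuous_on {0..2 * pi} ?w" by (rule continuous_on_arc_density[OF \<alpha>])
  have z1: "of_real \<alpha> * cis t \<noteq> 1" "of_real \<alpha> * cis t \<noteq> 0" for t
    using \<alpha> by (auto dest: arg_cong[of _ _ norm] simp: norm_mult)
  have powr: "2 * \<alpha> ^ Suc r / \<alpha> ^ (n - r) * \<alpha> = ?c"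
  proof -
    have "\<alpha> powr (2 * real r - real n + 2) = \<alpha> powr (real (Suc r) + 1 - real (n - r))"
      using rn by (intro arg_cong[of _ _ "\<lambda>x. \<alpha> powr x"]) (simp add: of_nat_diff)
    also have "\<dots> = \<alpha> ^ Suc r * \<alpha> / \<alpha> ^ (n - r)"
      using \<alpha> by (simp add: powr_diff powr_add powr_realpow power2_eq_square)
    finally show ?thesis by simp
  qed
  have bound: "norm (?W (0 + of_real \<alpha> * cis t) * of_real \<alpha> * \<i> * cis t) \<le> ?c * ?w t" for t
  proof -
    let ?z = "of_real \<alpha> * cis t"
    have "norm (1 + ?z ^ Suc r) \<le> 1 + \<alpha> ^ Suc r"
      using norm_triangle_ineq[of 1 "?z ^ Suc r"] \<alpha> by (simp add: norm_power norm_mult)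
    also have "\<dots> \<le> 2 * \<alpha> ^ Suc r" using one_le_power[of \<alpha> "Suc r"] \<alpha> by simp
    finally have 1: "norm (1 + ?z ^ Suc r) \<le> 2 * \<alpha> ^ Suc r" .
    have "norm (?W (0 + ?z) * of_real \<alpha> * \<i> * cis t) =
        norm (cycle_kernel r ?z) / norm (1 - ?z) ^ 3 * (norm (1 + ?z ^ Suc r) / \<alpha> ^ (n - r) * \<alpha>)"
      using \<alpha> by (simp add: norm_mult norm_divide norm_power)
    also have "\<dots> = ?w t * (norm (1 + ?z ^ Suc r) / \<alpha> ^ (n - r) * \<alpha>)"
      by (simp only: norm_cycle_kernel_cis norm_one_minus_cis arc_density_def)
    also have "\<dots> \<le> ?w t * (2 * \<alpha> ^ Suc r / \<alpha> ^ (n - r) * \<alpha>)"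
      using 1 \<alpha> dist_from_one_pos[OF \<alpha>, of t]
      by (intro mult_left_mono mult_right_mono divide_right_mono) (auto simp: arc_density_def)
    also have "\<dots> = ?c * ?w t" unfolding powr by (rule mult.commute)
    finally show ?thesis .
  qed
  have "contour_integral (circlepath 0 \<alpha>) ?W =
      integral {0..2 * pi} (\<lambda>t. ?W (0 + of_real \<alpha> * cis t) * of_real \<alpha> * \<i> * cis t)"
    unfolding circlepath_def by (rule contour_integral_part_circlepath_eq) simp
  also have "norm \<dots> \<le> integral {0..2 * pi} (\<lambda>t. ?c * ?w t)"
  proof (rule integral_norm_bound_integral)
    show "(\<lambda>t. ?W (0 + of_real \<alpha> * cis t) * of_real \<alpha> * \<i> * cis t) integrable_on {0..2 * pi}"
      using z1 unfolding cycle_kernel_def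
      by (intro integrable_continuous_real continuous_intros) auto
    show "(\<lambda>t. ?c * ?w t) integrable_on {0..2 * pi}"
      by (intro integrable_continuous_real continuous_intros cont)
  qed (use bound in auto)
  also have "\<dots> = ?c * (2 * integral {0..pi} ?w)"
    by (simp add: integral_arc_density_symmetric[OF \<alpha>])
  finally have "norm (of_nat (n * (n - r)) * (2 * pi * \<i> * of_real (kappa n r - exp (- harm r)))) \<le> \<dots>"
    by (simp only: kappa_contour_integral[OF \<alpha> rn(1)])
  then have "real (n * (n - r)) * (2 * pi * \<bar>kappa n r - exp (- harm r)\<bar>) \<le> ?c * (2 * integral {0..pi} ?w)"
    by (simp only: norm_mult norm_of_nat norm_of_real norm_ii norm_numeral mult_1_right real_norm_def abs_mult abs_of_nonneg pi_ge_zero abs_numeral)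
  moreover have "(real n)\<^sup>2 / 2 * (2 * pi * \<bar>kappa n r - exp (- harm r)\<bar>) \<le>
      real (n * (n - r)) * (2 * pi * \<bar>kappa n r - exp (- harm r)\<bar>)"
  proof (rule mult_right_mono)
    have "real n / 2 \<le> real (n - r)" using n rn by (simp add: of_nat_diff)
    then have "real n * (real n / 2) \<le> real n * real (n - r)" by (rule mult_left_mono) simp
    then show "(real n)\<^sup>2 / 2 \<le> real (n * (n - r))" by (simp add: power2_eq_square)
  qed simp
  ultimately have "(real n)\<^sup>2 / 2 * (2 * pi * \<bar>kappa n r - exp (- harm r)\<bar>) \<le> ?c * (2 * integral {0..pi} ?w)"
    by linarith
  also have "(real n)\<^sup>2 / 2 * (2 * pi * \<bar>kappa n r - exp (- harm r)\<bar>) =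
      \<bar>kappa n r - exp (- harm r)\<bar> * (pi * (real n)\<^sup>2)"
    by simp
  finally have "\<bar>kappa n r - exp (- harm r)\<bar> * (pi * (real n)\<^sup>2) \<le> ?c * (2 * integral {0..pi} ?w)" .
  then show ?thesis using rn
    by (simp add: pos_le_divide_eq)
qed

section \<open>Cosine sums and elementary estimates\<close>

lemma one_minus_cos_le: "1 - cos (x :: real) \<le> x\<^sup>2 / 2"
proof -
  have "cos x = 1 - 2 * (sin (x / 2))\<^sup>2"
    using cos_double_sin[of "x / 2"] by simp
  moreover have "\<bar>sin (x / 2)\<bar> \<le> \<bar>x / 2\<bar>" by (rule abs_sin_x_le_abs_x)
  then have "(sin (x / 2))\<^sup>2 \<le> (x / 2)\<^sup>2" by (simp only: abs_le_square_iff)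
  ultimately show ?thesis by (simp add: power2_eq_square)
qed

lemma sum_powers:
  fixes \<alpha> :: "'a :: field"
  assumes "\<alpha> \<noteq> 1" "m \<le> r"
  shows "(\<Sum>j=Suc m..r. \<alpha> ^ j) = (\<alpha> ^ Suc r - \<alpha> ^ Suc m) / (\<alpha> - 1)"
proof -
  have "(\<alpha> - 1) * (\<Sum>j=Suc m..r. \<alpha> ^ j) = \<alpha> ^ Suc r - \<alpha> ^ Suc m"
    using assms(2)
  proof (induction r rule: dec_induct)
    case (step n)
    then show ?case by (simp add: algebra_simps)
  qed simp
  then show ?thesis using assms(1) by (simp add: field_simps)
qed

text \<open>
  For \<open>t \<le> 1/r\<close> all angles \<open>j t\<close> are at most 1, hence \<open>cos (j t) \<ge> 1 - q\<^sup>2/2\<close> with \<open>q = j/r\<close>.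
  After the share \<open>q/2\<close> of \<open>\<alpha>\<^sup>j\<close> is set aside for the geometric sum, the remaining coefficient
  \<open>1 - q\<^sup>2/2 - q/2\<close> is nonnegative, so \<open>\<alpha>\<^sup>j\<close> may be replaced by 1 there. Each term loses at most \<open>1/r\<close>,
  and the losses add up to the constant 1.
\<close>

lemma near_arc_cos_sum:
  fixes \<alpha> t :: real
  assumes r: "1 \<le> r" and \<alpha>: "\<alpha> > 1" and t: "0 \<le> t" "t \<le> 1 / real r"
  shows "harm r + \<alpha> * (\<alpha> ^ r - 1) / (2 * real r * (\<alpha> - 1)) - 1
    \<le> (\<Sum>j=1..r. \<alpha> ^ j * cos (real j * t) / real j)"
proof -
  have termwise: "1 / real j + \<alpha> ^ j / (2 * real r) - 1 / real r \<le> \<alpha> ^ j * cos (real j * t) / real j"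
    if j: "j \<in> {1..r}" for j
  proof -
    have jr: "0 < real j" "real j \<le> real r" "0 < real r" using j by auto
    have "real j * t \<le> real j * (1 / real r)" using jr t by (intro mult_left_mono) auto
    then have "(real j * t)\<^sup>2 \<le> (real j / real r)\<^sup>2" using t jr by (intro power_mono) auto
    then have c: "1 - (real j / real r)\<^sup>2 / 2 \<le> cos (real j * t)"
      using one_minus_cos_le[of "real j * t"] by linarith
    define q where "q = real j / real r"
    have q: "0 < q" "q \<le> 1" using jr by (simp_all add: q_def)
    have q2: "q\<^sup>2 \<le> q" using q by (simp add: power2_eq_square mult_left_le)
    have "\<alpha> ^ j \<ge> 1" using \<alpha> by simp
    then have "1 * (1 - q\<^sup>2 / 2 - q / 2) \<le> \<alpha> ^ j * (1 - q\<^sup>2 / 2 - q / 2)"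
      using q q2 by (intro mult_right_mono) auto
    also have "\<dots> \<le> \<alpha> ^ j * (cos (real j * t) - q / 2)"
      using c \<alpha> by (intro mult_left_mono) (auto simp: q_def)
    finally have "1 - q + \<alpha> ^ j * (q / 2) \<le> \<alpha> ^ j * cos (real j * t)"
      using q2 by (simp add: algebra_simps)
    then have "(1 - q + \<alpha> ^ j * (q / 2)) / real j \<le> \<alpha> ^ j * cos (real j * t) / real j"
      using jr by (intro divide_right_mono) auto
    moreover have "(1 - q + \<alpha> ^ j * (q / 2)) / real j = 1 / real j + \<alpha> ^ j / (2 * real r) - 1 / real r"
      using jr by (simp add: q_def field_simps)
    ultimately show ?thesis by simp
  qed
  have "(\<Sum>j=1..r. 1 / real j + \<alpha> ^ j / (2 * real r) - 1 / real r) =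
      harm r + (\<Sum>j=1..r. \<alpha> ^ j) / (2 * real r) - 1"
    using r by (simp add: sum_subtractf sum.distrib harm_def sum_divide_distrib inverse_eq_divide)
  also have "(\<Sum>j=1..r. \<alpha> ^ j) / (2 * real r) = \<alpha> * (\<alpha> ^ r - 1) / (2 * real r * (\<alpha> - 1))"
    using sum_powers[of \<alpha> 0 r] \<alpha> by (simp add: algebra_simps)
  finally have "harm r + \<alpha> * (\<alpha> ^ r - 1) / (2 * real r * (\<alpha> - 1)) - 1 =
      (\<Sum>j=1..r. 1 / real j + \<alpha> ^ j / (2 * real r) - 1 / real r)" ..
  also have "\<dots> \<le> (\<Sum>j=1..r. \<alpha> ^ j * cos (real j * t) / real j)"
    by (rule sum_mono) (rule termwise)
  finally show ?thesis .
qed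

text \<open>
  The infinite damped series \<open>\<Sum> \<rho>\<^sup>j cos (j t) / j\<close> is the real part of a logarithm. Removing the
  damping from the first \<open>m\<close> terms costs at most \<open>1 - \<rho>\<close> each, because \<open>1 - \<rho>\<^sup>j \<le> j (1 - \<rho>)\<close>, and
  the discarded tail is dominated by a geometric series.
\<close>

lemma cos_sum_ge_abel_mean:
  fixes \<rho> t :: real
  assumes \<rho>: "0 \<le> \<rho>" "\<rho> < 1"
  shows "- ln (norm (1 - of_real \<rho> * cis t)) - real m * (1 - \<rho>) - \<rho> ^ Suc m / (real (Suc m) * (1 - \<rho>))
    \<le> (\<Sum>j=1..m. cos (real j * t) / real j)"
proof -
  let ?w = "of_real \<rho> * cis t"
  let ?S = "\<lambda>j. \<rho> ^ j * cos (real j * t) / real j"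
  have nw: "norm ?w < 1" using \<rho> by (simp add: norm_mult)
  then have w1: "1 - ?w \<noteq> 0" by auto
  have Re: "Re (- (?w ^ j) / of_nat j) = - ?S j" for j
    by (simp only: Re_divide_of_nat uminus_complex.sel Re_power_polar minus_divide_left [symmetric])
  have "(\<lambda>j. - ((- (- ?w)) ^ j) / of_nat j) sums ln (1 + - ?w)"
    by (rule Ln_series') (use nw in simp)
  then have "(\<lambda>j. Re (- (?w ^ j) / of_nat j)) sums Re (ln (1 - ?w))"
    by (intro sums_Re) simp
  then have "(\<lambda>j. - ?S j) sums ln (norm (1 - ?w))"
    by (simp only: Re Re_Ln[OF w1])
  then have S: "?S sums - ln (norm (1 - ?w))"
    using sums_minus by force
  have geo: "(\<lambda>i. \<rho> ^ i) sums (1 / (1 - \<rho>))" using \<rho> by (intro geometric_sums) simp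
  have "- ln (norm (1 - ?w)) = suminf ?S" using S by (simp add: sums_iff)
  also have "\<dots> = (\<Sum>i. ?S (i + Suc m)) + (\<Sum>i<Suc m. ?S i)"
    by (rule suminf_split_initial_segment) (use S in \<open>simp add: sums_iff\<close>)
  also have "(\<Sum>i. ?S (i + Suc m)) \<le> (\<Sum>i. \<rho> ^ Suc m / real (Suc m) * \<rho> ^ i)"
  proof (rule suminf_le)
    show "summable (\<lambda>i. ?S (i + Suc m))"
      using S by (subst summable_iff_shift) (simp add: sums_iff)
    show "summable (\<lambda>i. \<rho> ^ Suc m / real (Suc m) * \<rho> ^ i)"
      using geo by (intro summable_mult) (simp add: sums_iff)
    show "?S (i + Suc m) \<le> \<rho> ^ Suc m / real (Suc m) * \<rho> ^ i" for i
    proof -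
      have "?S (i + Suc m) \<le> \<rho> ^ (i + Suc m) * 1 / real (i + Suc m)"
        using \<rho> by (intro divide_right_mono mult_left_mono) auto
      also have "\<dots> \<le> \<rho> ^ (i + Suc m) * 1 / real (Suc m)"
        using \<rho> by (intro divide_left_mono) auto
      finally show ?thesis by (simp add: power_add mult_ac)
    qed
  qed
  also have "(\<Sum>i. \<rho> ^ Suc m / real (Suc m) * \<rho> ^ i) = \<rho> ^ Suc m / real (Suc m) * (1 / (1 - \<rho>))"
    using sums_mult[OF geo] by (rule sums_unique[symmetric])
  also have "(\<Sum>i<Suc m. ?S i) = (\<Sum>j=1..m. ?S j)"
    by (rule sum.mono_neutral_right) auto
  also have "\<dots> \<le> (\<Sum>j=1..m. cos (real j * t) / real j + (1 - \<rho>))"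
  proof (rule sum_mono)
    fix j assume j: "j \<in> {1..m}"
    have "1 - real j * (1 - \<rho>) \<le> \<rho> ^ j"
      using Bernoulli_inequality[of "\<rho> - 1" j] \<rho> by (simp add: algebra_simps)
    then have "(1 - \<rho> ^ j) * (- cos (real j * t)) \<le> real j * (1 - \<rho>) * 1"
      using \<rho> power_le_one[of \<rho> j] cos_ge_minus_one[of "real j * t"]
      by (intro order_trans[OF mult_left_mono[of _ 1] mult_right_mono]) (auto simp: minus_le_iff)
    then have "\<rho> ^ j * cos (real j * t) \<le> cos (real j * t) + real j * (1 - \<rho>)"
      by (simp add: algebra_simps)
    then have "?S j \<le> (cos (real j * t) + real j * (1 - \<rho>)) / real j"
      by (rule divide_right_mono) simp
    then show "?S j \<le> cos (real j * t) / real j + (1 - \<rho>)"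
      using j by (simp add: add_divide_distrib)
  qed
  also have "\<dots> = (\<Sum>j=1..m. cos (real j * t) / real j) + real m * (1 - \<rho>)"
    by (simp add: sum.distrib)
  finally show ?thesis by simp
qed

text \<open>
  Jordan's inequality: the concave sine lies above its chord.
\<close>

lemma sin_half_ge:
  fixes t :: real
  assumes "0 \<le> t" "t \<le> pi"
  shows "t / pi \<le> sin (t / 2)"
proof -
  have "concave_on {0..pi} sin"
    by (rule f''_le0_imp_concave[where f' = cos and f'' = "\<lambda>x. - sin x"])
       (auto intro!: derivative_eq_intros sin_ge_zero)
  from concave_onD[OF this, of "t / pi" 0 "pi / 2"] assms show ?thesis
    by (simp add: divide_simps)
qed

lemma dist_from_one_ge:
  fixes \<alpha> t :: real
  assumes "1 \<le> \<alpha>" "0 \<le> t" "t \<le> pi"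
  shows "(\<alpha> - 1)\<^sup>2 + 4 * \<alpha> / pi\<^sup>2 * t\<^sup>2 \<le> 1 - 2 * \<alpha> * cos t + \<alpha>\<^sup>2"
proof -
  have "cos t = 1 - 2 * (sin (t / 2))\<^sup>2"
    using cos_double_sin[of "t / 2"] by simp
  moreover have "(t / pi)\<^sup>2 \<le> (sin (t / 2))\<^sup>2"
    using sin_half_ge[OF assms(2,3)] assms(2) by (intro power_mono) auto
  then have "4 * \<alpha> * (t / pi)\<^sup>2 \<le> 4 * \<alpha> * (sin (t / 2))\<^sup>2"
    using assms by (intro mult_left_mono) auto
  moreover have "1 - 2 * \<alpha> * (1 - 2 * s) + \<alpha>\<^sup>2 = (\<alpha> - 1)\<^sup>2 + 4 * \<alpha> * s" for s
    by (simp add: power2_eq_square algebra_simps)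
  ultimately show ?thesis by (simp add: power_divide)
qed

lemma exp_one_bounds: "(5 / 2 :: real) < exp 1" "exp (- 1) \<le> (1 / 2 :: real)"
proof -
  show "(5 / 2 :: real) < exp 1"
    using exp_lower_Taylor_quadratic[of "1::real"] e_approx_32 by (simp add: abs_if split: if_splits)
  then show "exp (- 1) \<le> (1 / 2 :: real)"
    by (simp add: exp_minus inverse_eq_divide field_simps)
qed

text \<open>
  Up to a constant the sum is at least \<open>ln r + ln (1/t)\<close>: the terms \<open>1/j\<close> contribute \<open>ln r\<close>, the terms
  \<open>cos (j t) / j\<close> at least \<open>- ln t\<close>. The second part compares with the Abel mean whose damping
  \<open>\<rho> = 1 - 1/(m + 1)\<close> is adapted to the length of the sum, so that both comparison errors stay bounded,
  and \<open>1 - \<rho> \<le> 2 t\<close> makes \<open>|1 - \<rho> e\<^bsup>i t\<^esup>|\<close> of order \<open>t\<close>.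
\<close>

lemma lower_half_cos_sum:
  fixes t :: real
  assumes r: "1 \<le> r" and t: "1 / real r \<le> t"
  shows "exp (- (\<Sum>j=1..r div 2. (1 + cos (real j * t)) / real j)) \<le> 4 * exp 2 * t / real r"
proof -
  define m where "m = r div 2"
  define \<rho> where "\<rho> = 1 - 1 / real (Suc m)"
  let ?w = "of_real \<rho> * cis t"
  have t0: "0 < t" using t r by (smt (verit) divide_pos_pos of_nat_0_less_iff less_le_trans zero_less_one)
  have \<rho>: "0 \<le> \<rho>" "\<rho> < 1" "1 - \<rho> = 1 / real (Suc m)" by (simp_all add: \<rho>_def)
  have "r \<le> 2 * Suc m" unfolding m_def by presburger
  then have "real r \<le> real (2 * Suc m)" by (simp only: of_nat_le_iff)
  then have m: "real r \<le> 2 * real (Suc m)" by simp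
  have \<rho>t: "1 - \<rho> \<le> 2 * t"
  proof -
    have "1 / real (Suc m) \<le> 2 / real r" using m r by (simp add: divide_simps)
    then show ?thesis using t \<rho>(3) by simp
  qed
  have w1: "1 - ?w \<noteq> 0"
    using \<rho> by (auto dest: arg_cong[of _ _ norm] simp: norm_mult)
  have "norm (1 - ?w) \<le> 2 * exp (1/2) * t"
  proof -
    have "(norm (1 - ?w))\<^sup>2 = (1 - \<rho>)\<^sup>2 + 2 * \<rho> * (1 - cos t)"
    proof -
      have "(1 - \<rho> * c)\<^sup>2 + (\<rho> * s)\<^sup>2 = (1 - \<rho>)\<^sup>2 + 2 * \<rho> * (1 - c) + \<rho>\<^sup>2 * (s\<^sup>2 + c\<^sup>2 - 1)" for c s :: real
        by (simp add: power2_eq_square algebra_simps)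
      from this[of "cos t" "sin t"] show ?thesis by (simp add: cmod_power2)
    qed
    also have "\<dots> \<le> (2 * t)\<^sup>2 + 2 * 1 * (t\<^sup>2 / 2)"
      using \<rho> \<rho>t one_minus_cos_le[of t] by (intro add_mono power_mono mult_mono) auto
    also have "\<dots> \<le> 4 * exp 1 * t\<^sup>2"
    proof -
      have "5 * t\<^sup>2 \<le> (4 * exp 1) * t\<^sup>2"
        using exp_one_bounds(1) by (intro mult_right_mono) auto
      then show ?thesis by (simp add: power2_eq_square)
    qed
    also have "\<dots> = (2 * exp (1/2) * t)\<^sup>2"
      by (simp add: power_mult_distrib exp_double[symmetric])
    finally show ?thesis using t0 by (simp add: abs_le_square_iff[symmetric])
  qed
  moreover have "real m * (1 - \<rho>) + \<rho> ^ Suc m / (real (Suc m) * (1 - \<rho>)) \<le> 3 / 2"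
  proof -
    have "\<rho> ^ Suc m \<le> exp (- 1)"
      using exp_ge_one_minus_x_over_n_power_n[of 1 "Suc m"] by (simp add: \<rho>_def)
    moreover have "real m * (1 - \<rho>) \<le> 1" by (simp add: \<rho>(3))
    moreover have "real (Suc m) * (1 - \<rho>) = 1" unfolding \<rho>(3) by simp
    ultimately show ?thesis using exp_one_bounds(2) by simp
  qed
  ultimately have "exp (- (\<Sum>j=1..m. cos (real j * t) / real j)) \<le> 2 * exp (1/2) * t * exp (3/2)"
  proof -
    have "- (\<Sum>j=1..m. cos (real j * t) / real j) \<le> ln (norm (1 - ?w)) + 3 / 2"
      using cos_sum_ge_abel_mean[OF \<rho>(1,2), of t m]
        \<open>real m * (1 - \<rho>) + \<rho> ^ Suc m / (real (Suc m) * (1 - \<rho>)) \<le> 3 / 2\<close> by linarith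
    then have "exp (- (\<Sum>j=1..m. cos (real j * t) / real j)) \<le> exp (ln (norm (1 - ?w)) + 3 / 2)"
      by simp
    also have "\<dots> = norm (1 - ?w) * exp (3/2)" using w1 by (simp add: exp_add)
    also have "\<dots> \<le> 2 * exp (1/2) * t * exp (3/2)"
      using \<open>norm (1 - ?w) \<le> 2 * exp (1/2) * t\<close> by (intro mult_right_mono) auto
    finally show ?thesis .
  qed
  moreover have "exp (- harm m) \<le> 2 / real r"
  proof -
    have "exp (- harm m) \<le> exp (- ln (real m + 1))" using ln_le_harm[of m] by simp
    also have "\<dots> = 1 / (real m + 1)" by (simp add: exp_minus inverse_eq_divide)
    also have "\<dots> \<le> 2 / real r" using m r by (simp add: divide_simps)
    finally show ?thesis .
  qed
  ultimately have "exp (- harm m) * exp (- (\<Sum>j=1..m. cos (real j * t) / real j))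
      \<le> 2 / real r * (2 * exp (1/2) * t * exp (3/2))"
    by (intro mult_mono) auto
  also have "\<dots> = 4 * (exp (1/2) * exp (3/2)) * t / real r" by simp
  also have "exp (1/2) * exp (3/2) = exp (2 :: real)" by (simp flip: exp_add)
  also have "exp (- harm m) * exp (- (\<Sum>j=1..m. cos (real j * t) / real j)) =
      exp (- (\<Sum>j=1..m. (1 + cos (real j * t)) / real j))"
    by (simp add: exp_add[symmetric] harm_def sum.distrib add_divide_distrib inverse_eq_divide)
  finally show ?thesis by (simp only: m_def)
qed

text \<open>
  Since \<open>1/j \<ge> 1/r\<close>, the sum is at least \<open>1/r\<close> times a geometric sum and the real part of a complex
  geometric sum. The latter has denominator \<open>|z - 1|\<close> in place of \<open>\<alpha> - 1\<close> for \<open>z = \<alpha> e\<^bsup>i t\<^esup>\<close>, and for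
  \<open>t \<ge> 1/r\<close> this is larger by a definite factor, so it cannot cancel the former. The subtracted power
  \<open>\<alpha>\<^bsup>-r/2\<^esup>\<close> comes from the lower end of the summation range near \<open>r/2\<close>.
\<close>

lemma upper_half_cos_sum:
  fixes \<alpha> t :: real
  assumes r: "1 \<le> r" and \<alpha>: "\<alpha> > 1" and t: "1 / real r \<le> t" "t \<le> pi"
  shows "2 / real r * (\<alpha> ^ (r + 1) / (\<alpha> - 1)) *
      pos_part (pi powi (-2) / (1 + (real r * \<alpha> - real r)\<^sup>2) - \<alpha> powr (- real r / 2))
    \<le> (\<Sum>j=Suc (r div 2)..r. \<alpha> ^ j * (1 + cos (real j * t)) / real j)"
    (is "?c * pos_part (?p - ?q) \<le> ?S")
proof -
  define m where "m = r div 2"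
  define \<delta> where "\<delta> = \<alpha> - 1"
  let ?z = "of_real \<alpha> * cis t"
  define N where "N = norm (?z - 1)"
  have r0: "real r > 0" "m \<le> r" using r by (auto simp: m_def)
  have "2 * m \<le> r" unfolding m_def by presburger
  then have "real (2 * m) \<le> real r" by (simp only: of_nat_le_iff)
  then have m2: "2 * real m \<le> real r" by simp
  have t0: "0 \<le> t" using t r by (smt (verit) divide_nonneg_nonneg of_nat_0_le_iff)
  have \<delta>: "\<delta> > 0" using \<alpha> by (simp add: \<delta>_def)
  have S0: "0 \<le> ?S"
  proof (intro sum_nonneg divide_nonneg_nonneg mult_nonneg_nonneg)
    fix j show "0 \<le> 1 + cos (real j * t)" using cos_ge_minus_one[of "real j * t"] by linarith
  qed (use \<alpha> in auto)
  have N2: "N\<^sup>2 = 1 - 2 * \<alpha> * cos t + \<alpha>\<^sup>2"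
  proof -
    have "(\<alpha> * c - 1)\<^sup>2 + (\<alpha> * s)\<^sup>2 = 1 - 2 * \<alpha> * c + \<alpha>\<^sup>2 * (s\<^sup>2 + c\<^sup>2)" for c s :: real
      by (simp add: power2_eq_square algebra_simps)
    from this[of "cos t" "sin t"] show ?thesis by (simp add: cmod_power2 N_def)
  qed
  have N2ge: "\<delta>\<^sup>2 + 4 / (pi\<^sup>2 * (real r)\<^sup>2) \<le> N\<^sup>2"
  proof -
    have "1 * (1 / real r)\<^sup>2 \<le> \<alpha> * t\<^sup>2"
      using \<alpha> r0 t by (intro mult_mono power_mono) auto
    then have "4 / pi\<^sup>2 * (1 * (1 / real r)\<^sup>2) \<le> 4 / pi\<^sup>2 * (\<alpha> * t\<^sup>2)"
      by (intro mult_left_mono) auto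
    then show ?thesis using dist_from_one_ge[of \<alpha> t] \<alpha> t t0
      by (simp add: N2 \<delta>_def power_divide mult.assoc)
  qed
  then have "\<delta>\<^sup>2 \<le> N\<^sup>2" by (smt (verit) divide_nonneg_nonneg mult_nonneg_nonneg zero_le_power2)
  then have N\<delta>: "\<delta> \<le> N" using \<delta> by (simp add: abs_le_square_iff[symmetric] N_def)
  have N0: "N > 0" using N\<delta> \<delta> by linarith
  define x where "x = real r * \<delta>"
  \<comment> \<open>With \<open>q = \<delta> / N\<close> the gap \<open>1 - q\<close> is bounded through \<open>1 - q\<^sup>2 \<le> 2 (1 - q)\<close>, as \<open>q\<^sup>2\<close> is a rational function of \<open>x\<close>.\<close>
  have gap: "2 * ?p \<le> 1 - \<delta> / N"
  proof -
    have px: "0 < pi\<^sup>2 * x\<^sup>2 + 4" by (smt (verit) mult_nonneg_nonneg zero_le_power2)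
    have "(\<delta> / N)\<^sup>2 \<le> pi\<^sup>2 * x\<^sup>2 / (pi\<^sup>2 * x\<^sup>2 + 4)"
    proof -
      have "\<delta>\<^sup>2 * (pi\<^sup>2 * x\<^sup>2 + 4) = pi\<^sup>2 * (real r)\<^sup>2 * \<delta>\<^sup>2 * (\<delta>\<^sup>2 + 4 / (pi\<^sup>2 * (real r)\<^sup>2))"
        using r0 by (simp add: x_def field_simps)
      also have "\<dots> \<le> pi\<^sup>2 * (real r)\<^sup>2 * \<delta>\<^sup>2 * N\<^sup>2"
        using N2ge by (intro mult_left_mono) auto
      finally show ?thesis using px N0
        by (simp add: power_divide divide_simps x_def power_mult_distrib mult.commute mult.left_commute)
    qed
    moreover have "pi\<^sup>2 * x\<^sup>2 / (pi\<^sup>2 * x\<^sup>2 + 4) = 1 - 4 / (pi\<^sup>2 * x\<^sup>2 + 4)"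
      using px by (simp add: field_simps)
    moreover have "4 / (pi\<^sup>2 * (1 + x\<^sup>2)) \<le> 4 / (pi\<^sup>2 * x\<^sup>2 + 4)"
    proof -
      have "2\<^sup>2 \<le> pi\<^sup>2" using pi_ge_two by (intro power_mono) auto
      then show ?thesis using px by (intro divide_left_mono mult_pos_pos) (auto simp: algebra_simps add_pos_nonneg)
    qed
    ultimately have "4 / (pi\<^sup>2 * (1 + x\<^sup>2)) \<le> 1 - (\<delta> / N)\<^sup>2" by linarith
    moreover have "1 - (\<delta> / N)\<^sup>2 \<le> 2 * (1 - \<delta> / N)"
      using zero_le_power2[of "1 - \<delta> / N"] by (simp add: power2_eq_square algebra_simps)
    moreover have "4 / (pi\<^sup>2 * (1 + x\<^sup>2)) = 2 * (2 * ?p)"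
      by (simp add: x_def \<delta>_def algebra_simps power_int_minus inverse_eq_divide)
    ultimately have "2 * (2 * ?p) \<le> 2 * (1 - \<delta> / N)" by (metis order_trans)
    then show ?thesis by (simp only: mult_le_cancel_left_pos zero_less_numeral)
  qed
  have "\<alpha> ^ Suc r * (1 / \<delta> - 1 / N) - \<alpha> ^ Suc m * (1 / \<delta> + 1 / N) \<le> (\<Sum>j=Suc m..r. \<alpha> ^ j * (1 + cos (real j * t)))"
  proof -
    have z1: "?z \<noteq> 1" using N0 by (auto simp: N_def)
    have "(\<Sum>j=Suc m..r. \<alpha> ^ j * cos (real j * t)) = Re (\<Sum>j=Suc m..r. ?z ^ j)"
      by (simp only: Re_sum Re_power_polar)
    also have "\<dots> = Re ((?z ^ Suc r - ?z ^ Suc m) / (?z - 1))"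
      by (simp only: sum_powers[OF z1 r0(2)])
    finally have "- norm ((?z ^ Suc r - ?z ^ Suc m) / (?z - 1)) \<le> (\<Sum>j=Suc m..r. \<alpha> ^ j * cos (real j * t))"
      using abs_Re_le_cmod[of "(?z ^ Suc r - ?z ^ Suc m) / (?z - 1)"] by linarith
    moreover have "norm ((?z ^ Suc r - ?z ^ Suc m) / (?z - 1)) \<le> (\<alpha> ^ Suc r + \<alpha> ^ Suc m) / N"
    proof -
      have n: "norm (?z ^ k) = \<alpha> ^ k" for k using \<alpha> by (simp add: norm_power norm_mult)
      have "norm (?z ^ Suc r - ?z ^ Suc m) \<le> \<alpha> ^ Suc r + \<alpha> ^ Suc m"
        using norm_triangle_ineq4[of "?z ^ Suc r" "?z ^ Suc m"] by (simp only: n)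
      then have "norm (?z ^ Suc r - ?z ^ Suc m) / N \<le> (\<alpha> ^ Suc r + \<alpha> ^ Suc m) / N"
        using N0 by (intro divide_right_mono) auto
      then show ?thesis by (simp only: norm_divide N_def)
    qed
    ultimately have "- ((\<alpha> ^ Suc r + \<alpha> ^ Suc m) / N) \<le> (\<Sum>j=Suc m..r. \<alpha> ^ j * cos (real j * t))"
      by linarith
    moreover have "(\<Sum>j=Suc m..r. \<alpha> ^ j) = (\<alpha> ^ Suc r - \<alpha> ^ Suc m) / \<delta>"
      unfolding \<delta>_def by (rule sum_powers) (use \<alpha> r0 in auto)
    moreover have "(\<Sum>j=Suc m..r. \<alpha> ^ j * (1 + cos (real j * t))) =
        (\<Sum>j=Suc m..r. \<alpha> ^ j) + (\<Sum>j=Suc m..r. \<alpha> ^ j * cos (real j * t))"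
      by (simp add: distrib_left sum.distrib)
    moreover have "a * (1 / \<delta> - 1 / N) - b * (1 / \<delta> + 1 / N) = (a - b) / \<delta> + - ((a + b) / N)" for a b
      by (simp add: algebra_simps diff_divide_distrib add_divide_distrib)
    ultimately show ?thesis by (simp only: add_le_cancel_left)
  qed
  moreover have "\<alpha> ^ Suc r / \<delta> * (2 * ?p) \<le> \<alpha> ^ Suc r * (1 / \<delta> - 1 / N)"
  proof -
    have "\<alpha> ^ Suc r / \<delta> * (2 * ?p) \<le> \<alpha> ^ Suc r / \<delta> * (1 - \<delta> / N)"
      using gap \<alpha> \<delta> by (intro mult_left_mono) auto
    also have "\<dots> = \<alpha> ^ Suc r * (1 / \<delta> - 1 / N)" using \<delta> by (simp add: field_simps)
    finally show ?thesis .
  qed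
  moreover have "\<alpha> ^ Suc m * (1 / \<delta> + 1 / N) \<le> \<alpha> ^ Suc r / \<delta> * (2 * ?q)"
  proof -
    have "\<alpha> ^ Suc m = \<alpha> powr real (Suc m)" using \<alpha> by (simp only: powr_realpow)
    also have "\<dots> \<le> \<alpha> powr (real (Suc r) + - real r / 2)"
      using m2 \<alpha> by (intro powr_mono) auto
    also have "\<dots> = \<alpha> ^ Suc r * ?q" using \<alpha> by (simp only: powr_add powr_realpow)
    finally have "\<alpha> ^ Suc m \<le> \<alpha> ^ Suc r * ?q" .
    moreover have "1 / \<delta> + 1 / N \<le> 2 / \<delta>"
      using N\<delta> \<delta> frac_le[of 1 1 \<delta> N] by simp
    ultimately have "\<alpha> ^ Suc m * (1 / \<delta> + 1 / N) \<le> (\<alpha> ^ Suc r * ?q) * (2 / \<delta>)"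
      using \<alpha> \<delta> N0 by (intro mult_mono) auto
    then show ?thesis by (simp add: mult_ac)
  qed
  ultimately have "\<alpha> ^ Suc r / \<delta> * (2 * ?p) - \<alpha> ^ Suc r / \<delta> * (2 * ?q) \<le> (\<Sum>j=Suc m..r. \<alpha> ^ j * (1 + cos (real j * t)))"
    by linarith
  then have "(\<alpha> ^ Suc r / \<delta> * (2 * ?p) - \<alpha> ^ Suc r / \<delta> * (2 * ?q)) / real r
      \<le> (\<Sum>j=Suc m..r. \<alpha> ^ j * (1 + cos (real j * t))) / real r"
    by (rule divide_right_mono) simp
  also have "\<dots> \<le> ?S"
    unfolding sum_divide_distrib m_def[symmetric]
  proof (rule sum_mono)
    fix j assume j: "j \<in> {Suc m..r}"
    have "0 \<le> 1 + cos (real j * t)" using cos_ge_minus_one[of "real j * t"] by linarith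
    then show "\<alpha> ^ j * (1 + cos (real j * t)) / real r \<le> \<alpha> ^ j * (1 + cos (real j * t)) / real j"
      using j \<alpha> by (intro divide_left_mono mult_nonneg_nonneg) auto
  qed
  also have "(\<alpha> ^ Suc r / \<delta> * (2 * ?p) - \<alpha> ^ Suc r / \<delta> * (2 * ?q)) / real r = ?c * (?p - ?q)"
  proof -
    have "(a / \<delta> * (2 * p) - a / \<delta> * (2 * q)) / real r = 2 / real r * (a / \<delta>) * (p - q)" for a p q
      by (simp add: right_diff_distrib diff_divide_distrib mult_ac)
    then show ?thesis by (simp only: \<delta>_def Suc_eq_plus1)
  qed
  finally have "?c * (?p - ?q) \<le> ?S" .
  then show ?thesis using S0 by (simp add: pos_part_def max_def)
qed

text \<open>
  The integrand has the primitive \<open>- 1 / (B sqrt (\<delta>\<^sup>2 + B t\<^sup>2))\<close>. The bound of order \<open>1/\<delta>\<close> is what the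
  linear factor \<open>t\<close> gains: without it the integral over \<open>t \<ge> 0\<close> is of order \<open>1/\<delta>\<^sup>2\<close>.
\<close>

lemma integral_odd_kernel_le:
  fixes \<delta> B a b :: real
  assumes "0 < \<delta>" "0 < B" "a \<le> b"
  shows "(\<lambda>t. t / sqrt (\<delta>\<^sup>2 + B * t\<^sup>2) ^ 3) integrable_on {a..b}"
    and "integral {a..b} (\<lambda>t. t / sqrt (\<delta>\<^sup>2 + B * t\<^sup>2) ^ 3) \<le> 1 / (B * \<delta>)"
proof -
  let ?s = "\<lambda>t. sqrt (\<delta>\<^sup>2 + B * t\<^sup>2)"
  let ?F = "\<lambda>t. - 1 / (B * ?s t)"
  have pos: "\<delta>\<^sup>2 + B * t\<^sup>2 > 0" for t
    using assms by (simp add: add_pos_nonneg)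
  have s: "?s t > 0" "\<delta> \<le> ?s t" for t
    using pos[of t] assms by (auto intro!: real_le_rsqrt)
  have "((\<lambda>t. t / ?s t ^ 3) has_integral ?F b - ?F a) {a..b}"
  proof (rule fundamental_theorem_of_calculus[OF assms(3)])
    fix t assume "t \<in> {a..b}"
    have "(?s has_real_derivative (2 * B * t) * (inverse (?s t) / 2)) (at t)"
      using pos[of t] by (auto intro!: derivative_eq_intros)
    then have "(?F has_real_derivative (B * ((2 * B * t) * (inverse (?s t) / 2))) / (B * ?s t * (B * ?s t))) (at t)"
      using s[of t] assms by (auto intro!: derivative_eq_intros)
    also have "(B * ((2 * B * t) * (inverse (?s t) / 2))) / (B * ?s t * (B * ?s t)) = t / ?s t ^ 3"
      using s(1)[of t] assms(2) by (simp add: inverse_eq_divide power3_eq_cube)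
    finally show "(?F has_vector_derivative t / ?s t ^ 3) (at t within {a..b})"
      by (simp add: has_real_derivative_iff_has_vector_derivative[symmetric] has_field_derivative_at_within)
  qed
  then show "(\<lambda>t. t / ?s t ^ 3) integrable_on {a..b}"
    and "integral {a..b} (\<lambda>t. t / ?s t ^ 3) \<le> 1 / (B * \<delta>)"
  proof -
    assume I: "((\<lambda>t. t / ?s t ^ 3) has_integral ?F b - ?F a) {a..b}"
    show "(\<lambda>t. t / ?s t ^ 3) integrable_on {a..b}" using I by blast
    have "integral {a..b} (\<lambda>t. t / ?s t ^ 3) = 1 / (B * ?s a) - 1 / (B * ?s b)"
      using I by (simp add: integral_unique)
    also have "\<dots> \<le> 1 / (B * ?s a)" using s(1)[of b] assms(2) by simp
    also have "\<dots> \<le> 1 / (B * \<delta>)"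
      using s[of a] assms by (intro divide_left_mono mult_left_mono mult_pos_pos) auto
    finally show "integral {a..b} (\<lambda>t. t / ?s t ^ 3) \<le> 1 / (B * \<delta>)" .
  qed
qed

text \<open>
  This is what the minimum in the error exponent has to pay for. Because \<open>harm r \<le> ln r + 1\<close>, the right-hand
  side is at least \<open>\<alpha>\<^bsup>2r\<^esup> / r\<^sup>2\<close> or \<open>exp 2\<close>, and \<open>\<alpha>\<^bsup>2r\<^esup> \<ge> (1 + x)\<^sup>2 \<ge> 4 x\<close> with \<open>x = r (\<alpha> - 1)\<close>.
\<close>

lemma min_factor_ge:
  fixes \<alpha> :: real
  assumes r: "1 \<le> r" and \<alpha>: "\<alpha> > 1"
  shows "min (4 * (\<alpha> - 1) / real r) (exp 2) \<le>
    exp 2 * exp (- 2 * harm r + min (2 * real r * ln \<alpha>) (2 * ln (exp 1 * real r)))"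
    (is "_ \<le> exp 2 * exp (- 2 * harm r + min ?a ?b)")
proof -
  have r0: "real r > 0" using r by simp
  have H: "harm r \<le> ln (real r) + 1"
    using euler_mascheroni_sequence_decreasing[of 1 r] r by (simp add: harm_expand)
  have "min (4 * (\<alpha> - 1) / real r) (exp 2) \<le> exp (- 2 * ln (real r) + min ?a ?b)"
  proof (cases "?a \<le> ?b")
    case True
    define x where "x = real r * (\<alpha> - 1)"
    have "1 + x \<le> \<alpha> ^ r"
      using Bernoulli_inequality[of "\<alpha> - 1" r] \<alpha> by (simp add: x_def)
    moreover have "0 \<le> x" using \<alpha> by (simp add: x_def)
    ultimately have "(1 + x)\<^sup>2 \<le> (\<alpha> ^ r)\<^sup>2" by (intro power_mono) auto
    moreover have "4 * x \<le> (1 + x)\<^sup>2"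
      using zero_le_power2[of "1 - x"] by (simp add: power2_eq_square algebra_simps)
    ultimately have "4 * x / (real r)\<^sup>2 \<le> (\<alpha> ^ r)\<^sup>2 / (real r)\<^sup>2" by (intro divide_right_mono) auto
    moreover have "4 * x / (real r)\<^sup>2 = 4 * (\<alpha> - 1) / real r"
      using r0 by (simp add: x_def power2_eq_square)
    moreover have "exp (- 2 * ln (real r) + ?a) = (\<alpha> ^ r)\<^sup>2 / (real r)\<^sup>2"
    proof -
      have "exp (real r * ln \<alpha>) = \<alpha> ^ r" using \<alpha> by (simp add: exp_of_nat_mult)
      moreover have "exp (- ln (real r)) = 1 / real r" using r0 by (simp add: exp_minus inverse_eq_divide)
      moreover have "exp (- 2 * ln (real r) + ?a) = (exp (- ln (real r)) * exp (real r * ln \<alpha>))\<^sup>2"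
        by (simp add: power2_eq_square flip: exp_add)
      ultimately show ?thesis by (simp add: power_mult_distrib power_divide)
    qed
    ultimately show ?thesis using True by (simp add: min_def)
  next
    case False
    have "?b = 2 + 2 * ln (real r)" using r0 by (simp add: ln_mult)
    then show ?thesis using False by (simp add: min_def)
  qed
  also have "\<dots> \<le> exp (2 + (- 2 * harm r + min ?a ?b))"
    unfolding exp_le_cancel_iff using H by linarith
  also have "\<dots> = exp 2 * exp (- 2 * harm r + min ?a ?b)" by (rule exp_add)
  finally show ?thesis .
qed

section \<open>The near arc and the far arc\<close>

lemma arc_density_near:
  assumes r: "1 \<le> r" and \<alpha>: "\<alpha> > 1" and t: "0 \<le> t" "t \<le> 1 / real r"
  shows "arc_density r \<alpha> t \<le>
    exp (1 - harm r - \<alpha> * (\<alpha> ^ r - 1) / (2 * real r * (\<alpha> - 1))) / (\<alpha> - 1) ^ 3"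
  unfolding arc_density_def
proof (rule frac_le)
  show "exp (- (\<Sum>j=1..r. \<alpha> ^ j * cos (real j * t) / real j)) \<le>
      exp (1 - harm r - \<alpha> * (\<alpha> ^ r - 1) / (2 * real r * (\<alpha> - 1)))"
    using near_arc_cos_sum[OF assms] unfolding exp_le_cancel_iff by linarith
  have "\<alpha> * cos t \<le> \<alpha> * 1" using \<alpha> by (intro mult_left_mono) auto
  then have "(\<alpha> - 1)\<^sup>2 \<le> 1 - 2 * \<alpha> * cos t + \<alpha>\<^sup>2"
    by (simp add: power2_eq_square algebra_simps)
  then have "\<alpha> - 1 \<le> sqrt (1 - 2 * \<alpha> * cos t + \<alpha>\<^sup>2)" by (rule real_le_rsqrt)
  then show "(\<alpha> - 1) ^ 3 \<le> sqrt (1 - 2 * \<alpha> * cos t + \<alpha>\<^sup>2) ^ 3"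
    using \<alpha> by (intro power_mono) auto
qed (use \<alpha> in auto)

text \<open>
  Write \<open>cos = (1 + cos) - 1\<close>: the \<open>- 1\<close> produces the trivial maximum \<open>exp (\<Sum> \<alpha>\<^sup>j / j)\<close>, and the nonnegative
  terms with \<open>1 + cos\<close> improve it. Those with \<open>j > r/2\<close> yield the exponential correction; those with \<open>j \<le> r/2\<close>
  yield a factor of order \<open>t / r\<close>.
\<close>

lemma arc_density_far:
  fixes \<alpha> t :: real and r :: nat
  defines "corr \<equiv> 2 / real r * (\<alpha> ^ (r + 1) / (\<alpha> - 1)) *
      pos_part (pi powi (-2) / (1 + (real r * \<alpha> - real r)\<^sup>2) - \<alpha> powr (- real r / 2))"
  assumes r: "1 \<le> r" and \<alpha>: "\<alpha> > 1" and t: "1 / real r \<le> t" "t \<le> pi"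
  shows "arc_density r \<alpha> t \<le>
    exp ((\<Sum>j=1..r. \<alpha> ^ j / real j) - corr) * min 1 (4 * exp 2 * t / real r) /
      sqrt ((\<alpha> - 1)\<^sup>2 + 4 * \<alpha> / pi\<^sup>2 * t\<^sup>2) ^ 3"
proof -
  define m where "m = r div 2"
  let ?P = "\<Sum>j=1..r. \<alpha> ^ j / real j"
  let ?L = "\<Sum>j=1..m. (1 + cos (real j * t)) / real j"
  let ?U = "\<Sum>j=Suc m..r. \<alpha> ^ j * (1 + cos (real j * t)) / real j"
  have t0: "0 \<le> t" using t(1) by (rule order_trans[rotated]) simp
  have c: "0 \<le> 1 + cos (real j * t)" for j using cos_ge_minus_one[of "real j * t"] by linarith
  have "?L \<le> (\<Sum>j=1..m. \<alpha> ^ j * (1 + cos (real j * t)) / real j)"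
  proof (intro sum_mono divide_right_mono)
    fix j
    show "1 + cos (real j * t) \<le> \<alpha> ^ j * (1 + cos (real j * t))"
      using mult_right_mono[OF one_le_power[of \<alpha> j] c[of j]] \<alpha> by simp
  qed simp
  moreover have "(\<Sum>j=1..m. \<alpha> ^ j * (1 + cos (real j * t)) / real j) + ?U =
      (\<Sum>j=1..r. \<alpha> ^ j * (1 + cos (real j * t)) / real j)"
    using sum.ub_add_nat[of 1 m "\<lambda>j. \<alpha> ^ j * (1 + cos (real j * t)) / real j" "r - m"]
    by (simp add: m_def)
  moreover have "(\<Sum>j=1..r. \<alpha> ^ j * (1 + cos (real j * t)) / real j) =
      ?P + (\<Sum>j=1..r. \<alpha> ^ j * cos (real j * t) / real j)"
    by (simp add: distrib_left add_divide_distrib sum.distrib)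
  moreover have "corr \<le> ?U"
    unfolding corr_def m_def by (rule upper_half_cos_sum[OF r \<alpha> t])
  ultimately have le: "- (\<Sum>j=1..r. \<alpha> ^ j * cos (real j * t) / real j) \<le> (?P - corr) + - ?L"
    by linarith
  have "exp (- ?L) \<le> min 1 (4 * exp 2 * t / real r)"
    using lower_half_cos_sum[OF r t(1)] c by (auto simp: m_def intro!: sum_nonneg divide_nonneg_nonneg)
  then have "exp (?P - corr) * exp (- ?L) \<le> exp (?P - corr) * min 1 (4 * exp 2 * t / real r)"
    by (rule mult_left_mono) simp
  moreover have "exp (- (\<Sum>j=1..r. \<alpha> ^ j * cos (real j * t) / real j)) \<le> exp (?P - corr) * exp (- ?L)"
    using le by (simp flip: exp_add)
  ultimately have num: "exp (- (\<Sum>j=1..r. \<alpha> ^ j * cos (real j * t) / real j)) \<le>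
      exp (?P - corr) * min 1 (4 * exp 2 * t / real r)"
    by linarith
  have pos: "0 < (\<alpha> - 1)\<^sup>2 + 4 * \<alpha> / pi\<^sup>2 * t\<^sup>2"
    using \<alpha> by (intro add_pos_nonneg) auto
  show ?thesis
    unfolding arc_density_def
  proof (rule frac_le)
    show "sqrt ((\<alpha> - 1)\<^sup>2 + 4 * \<alpha> / pi\<^sup>2 * t\<^sup>2) ^ 3 \<le> sqrt (1 - 2 * \<alpha> * cos t + \<alpha>\<^sup>2) ^ 3"
      using dist_from_one_ge[of \<alpha> t] \<alpha> t t0 pos by (intro power_mono) auto
  qed (use num pos t0 in auto)
qed

lemma integral_near:
  assumes r: "1 \<le> r" and \<alpha>: "\<alpha> > 1"
  shows "integral {0..1 / real r} (arc_density r \<alpha>) \<le>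
    exp (1 - harm r - \<alpha> * (\<alpha> ^ r - 1) / (2 * real r * (\<alpha> - 1))) / (real r * (\<alpha> - 1) ^ 3)"
    (is "_ \<le> ?e / _")
proof -
  have "integral {0..1 / real r} (arc_density r \<alpha>) \<le> integral {0..1 / real r} (\<lambda>t. ?e / (\<alpha> - 1) ^ 3)"
    using arc_density_near[OF assms]
    by (intro integral_le integrable_continuous_real continuous_on_arc_density[OF \<alpha>]) auto
  also have "\<dots> = ?e / (real r * (\<alpha> - 1) ^ 3)" by simp
  finally show ?thesis .
qed

text \<open>
  If \<open>\<alpha> - 1 \<le> r\<close>, the factor \<open>t / r\<close> keeps the integral of order \<open>1 / (r (\<alpha> - 1))\<close>, and
  \<open>min_factor_ge\<close> absorbs the remaining quotient \<open>(\<alpha> - 1) / r\<close>. If \<open>\<alpha> - 1 > r\<close>, the circle stays so far from 1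
  that the trivial bound \<open>|1 - z| \<ge> \<alpha> - 1\<close> suffices.
\<close>

lemma integral_far:
  fixes \<alpha> :: real and r :: nat
  assumes r: "1 \<le> r" and \<alpha>: "\<alpha> > 1"
  shows "integral {1 / real r..pi} (arc_density r \<alpha>) \<le>
    pi\<^sup>2 * exp 4 / (4 * sqrt \<alpha> * (\<alpha> - 1)\<^sup>2) *
      exp ((\<Sum>j=1..r. (\<alpha> ^ j - 2) / real j) + err_exponent r \<alpha>)"
proof -
  define \<delta> where "\<delta> = \<alpha> - 1"
  define B where "B = 4 * \<alpha> / pi\<^sup>2"
  define corr where "corr = 2 / real r * (\<alpha> ^ (r + 1) / (\<alpha> - 1)) *
      pos_part (pi powi (-2) / (1 + (real r * \<alpha> - real r)\<^sup>2) - \<alpha> powr (- real r / 2))"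
  define K where "K = exp ((\<Sum>j=1..r. \<alpha> ^ j / real j) - corr)"
  define X where "X = exp (- 2 * harm r + min (2 * real r * ln \<alpha>) (2 * ln (exp 1 * real r)))"
  let ?D = "\<lambda>t. sqrt (\<delta>\<^sup>2 + B * t\<^sup>2)"
  have "1 / real r \<le> 1" using r by simp
  then have r0: "real r > 0" "1 / real r \<le> pi" using r pi_ge_two by (simp, linarith)
  have \<delta>: "\<delta> > 0" and B: "B > 0" using \<alpha> by (simp_all add: \<delta>_def B_def)
  have K: "K > 0" and X: "X > 0" by (simp_all add: K_def X_def)
  have KX: "exp ((\<Sum>j=1..r. (\<alpha> ^ j - 2) / real j) + err_exponent r \<alpha>) = K * X"
  proof -
    have "(\<Sum>j=1..r. (\<alpha> ^ j - 2) / real j) = (\<Sum>j=1..r. \<alpha> ^ j / real j) - 2 * harm r"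
      by (simp add: diff_divide_distrib sum_subtractf harm_def sum_distrib_left inverse_eq_divide)
    moreover have "err_exponent r \<alpha> = - corr + min (2 * real r * ln \<alpha>) (2 * ln (exp 1 * real r))"
      by (simp add: err_exponent_def corr_def)
    ultimately show ?thesis by (simp add: K_def X_def flip: exp_add)
  qed
  have far: "arc_density r \<alpha> t \<le> K * min 1 (4 * exp 2 * t / real r) / ?D t ^ 3"
    if "t \<in> {1 / real r..pi}" for t
    using arc_density_far[OF r \<alpha>, of t] that by (simp add: K_def corr_def \<delta>_def B_def)
  have min: "min (4 * \<delta> / real r) (exp 2) \<le> exp 2 * X"
    using min_factor_ge[OF r \<alpha>] by (simp add: \<delta>_def X_def)
  have e2: "4 \<le> exp (2 :: real)"
  proof -
    have "(2 :: real)\<^sup>2 \<le> (exp 1)\<^sup>2" using exp_one_bounds(1) by (intro power_mono) auto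
    then show ?thesis by (simp add: exp_double[symmetric])
  qed
  have e4: "exp 4 = exp 2 * (exp 2 :: real)" by (simp flip: exp_add)
  have sq: "sqrt \<alpha> * sqrt \<alpha> = \<alpha>" "1 \<le> sqrt \<alpha>" using \<alpha> by auto
  have intw: "arc_density r \<alpha> integrable_on {1 / real r..pi}"
    by (intro integrable_continuous_real continuous_on_arc_density[OF \<alpha>])
  have "integral {1 / real r..pi} (arc_density r \<alpha>) \<le> pi\<^sup>2 * exp 4 / (4 * sqrt \<alpha> * \<delta>\<^sup>2) * (K * X)"
  proof (cases "\<delta> \<le> real r")
    case True
    \<comment> \<open>Keeping the factor \<open>t\<close> in the numerator saves one power of \<open>\<delta>\<close> in the integral.\<close>
    have "integral {1 / real r..pi} (arc_density r \<alpha>) \<le>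
        integral {1 / real r..pi} (\<lambda>t. 4 * exp 2 * K / real r * (t / ?D t ^ 3))"
    proof (rule integral_le[OF intw])
      show "(\<lambda>t. 4 * exp 2 * K / real r * (t / ?D t ^ 3)) integrable_on {1 / real r..pi}"
        by (intro integrable_on_mult_right integral_odd_kernel_le(1)[OF \<delta> B r0(2)])
      fix t assume t: "t \<in> {1 / real r..pi}"
      have "K * min 1 (4 * exp 2 * t / real r) / ?D t ^ 3 \<le> K * (4 * exp 2 * t / real r) / ?D t ^ 3"
        using K B by (intro divide_right_mono mult_left_mono) auto
      also have "\<dots> = 4 * exp 2 * K / real r * (t / ?D t ^ 3)" by simp
      finally show "arc_density r \<alpha> t \<le> 4 * exp 2 * K / real r * (t / ?D t ^ 3)"
        using far[OF t] by linarith
    qed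
    also have "\<dots> = 4 * exp 2 * K / real r * integral {1 / real r..pi} (\<lambda>t. t / ?D t ^ 3)"
      by (rule integral_mult_right)
    also have "\<dots> \<le> 4 * exp 2 * K / real r * (1 / (B * \<delta>))"
      using K r0 by (intro mult_left_mono integral_odd_kernel_le(2)[OF \<delta> B r0(2)]) auto
    also have "\<dots> = pi\<^sup>2 * exp 2 * K / (4 * \<alpha> * \<delta>\<^sup>2) * (4 * \<delta> / real r)"
      using \<delta> \<alpha> r0 by (simp add: B_def field_simps power2_eq_square)
    also have "\<dots> \<le> pi\<^sup>2 * exp 2 * K / (4 * \<alpha> * \<delta>\<^sup>2) * (exp 2 * X)"
    proof (rule mult_left_mono)
      have "4 * \<delta> / real r \<le> 4" using True r0 by (simp add: divide_simps)
      then show "4 * \<delta> / real r \<le> exp 2 * X" using min e2 by linarith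
    qed (use K \<alpha> in auto)
    also have "\<dots> \<le> pi\<^sup>2 * exp 2 * K / (4 * sqrt \<alpha> * \<delta>\<^sup>2) * (exp 2 * X)"
      using K X \<delta> \<alpha> sq mult_left_mono[OF sq(2), of "sqrt \<alpha>"]
      by (intro mult_right_mono divide_left_mono mult_pos_pos mult_left_mono) auto
    also have "\<dots> = pi\<^sup>2 * exp 4 / (4 * sqrt \<alpha> * \<delta>\<^sup>2) * (K * X)"
      by (simp add: e4)
    finally show ?thesis .
  next
    case False
    then have \<delta>1: "1 \<le> \<delta>" "real r < \<delta>" using r by auto
    have "integral {1 / real r..pi} (arc_density r \<alpha>) \<le> integral {1 / real r..pi} (\<lambda>t. K / \<delta> ^ 3)"
    proof (rule integral_le[OF intw])
      fix t assume t: "t \<in> {1 / real r..pi}"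
      have "\<delta> \<le> ?D t" using B by (intro real_le_rsqrt) simp
      then have "K * min 1 (4 * exp 2 * t / real r) / ?D t ^ 3 \<le> K / \<delta> ^ 3"
        using K \<delta> by (intro frac_le power_mono) (auto simp: mult_le_cancel_left1)
      then show "arc_density r \<alpha> t \<le> K / \<delta> ^ 3" using far[OF t] by linarith
    qed auto
    also have "\<dots> = (pi - 1 / real r) * (K / \<delta> ^ 3)" using r0(2) by simp
    also have "\<dots> \<le> pi * (K / \<delta> ^ 3)"
      using K \<delta> by (intro mult_right_mono) auto
    also have "\<dots> = pi * K / (4 * sqrt \<alpha> * \<delta>\<^sup>2) * (4 * sqrt \<alpha> / \<delta>)"
      using \<delta> \<alpha> by (simp add: field_simps power2_eq_square power3_eq_cube)
    also have "\<dots> \<le> pi * K / (4 * sqrt \<alpha> * \<delta>\<^sup>2) * (pi * exp 2 * (exp 2 * X))"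
    proof (rule mult_left_mono)
      have "sqrt \<alpha> \<le> \<alpha>" using mult_left_mono[OF sq(2), of "sqrt \<alpha>"] sq \<alpha> by simp
      then have "4 * sqrt \<alpha> / \<delta> \<le> 4 * (2 * \<delta>) / \<delta>"
        using \<delta>1 \<delta> by (intro divide_right_mono) (auto simp: \<delta>_def)
      also have "\<dots> \<le> 2 * 4 * 4" using \<delta> by simp
      also have "\<dots> \<le> pi * exp 2 * (exp 2 * X)"
      proof -
        have "4 \<le> 4 * \<delta> / real r" using \<delta>1 r0 by (simp add: divide_simps)
        then have "4 \<le> exp 2 * X" using min e2 by linarith
        then show ?thesis using pi_ge_two e2 by (intro mult_mono) auto
      qed
      finally show "4 * sqrt \<alpha> / \<delta> \<le> pi * exp 2 * (exp 2 * X)" .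
    qed (use K \<alpha> in auto)
    also have "\<dots> = pi\<^sup>2 * exp 4 / (4 * sqrt \<alpha> * \<delta>\<^sup>2) * (K * X)"
      by (simp add: e4 power2_eq_square)
    finally show ?thesis .
  qed
  then show ?thesis by (simp only: KX \<delta>_def)
qed

theorem theorem3p2:
  fixes n r :: nat and \<alpha> :: real
  assumes "1 \<le> r" and "real r < real n / 2" and "\<alpha> > 1"
  shows "\<bar>kappa n r - exp (- harm r)\<bar>
    \<le> pi * exp 4 * \<alpha> powr (2 * real r - real n + 3 / 2) / ((real n)\<^sup>2 * (\<alpha> - 1)\<^sup>2)
        * exp ((\<Sum>j=1..r. (\<alpha> ^ j - 2) / real j) + err_exponent r \<alpha>)
      + 4 * exp 1 * \<alpha> powr (2 * real r - real n + 2) / (pi * (real n)\<^sup>2 * real r * (\<alpha> - 1) ^ 3)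
        * exp (- (\<alpha> * (\<alpha> ^ r - 1) / (2 * real r * (\<alpha> - 1))) - harm r)"
proof -
  let ?w = "arc_density r \<alpha>"
  let ?S = "exp ((\<Sum>j=1..r. (\<alpha> ^ j - 2) / real j) + err_exponent r \<alpha>)"
  let ?A = "\<alpha> * (\<alpha> ^ r - 1) / (2 * real r * (\<alpha> - 1))"
  let ?p = "\<alpha> powr (2 * real r - real n + 2)"
  let ?c = "4 * ?p / (pi * (real n)\<^sup>2)"
  have "1 / real r \<le> 1" using assms(1) by simp
  then have r0: "real r > 0" "1 / real r \<le> pi" using assms(1) pi_ge_two by (simp, linarith)
  have n0: "real n > 0" using assms by simp
  have split: "integral {0..pi} ?w = integral {1 / real r..pi} ?w + integral {0..1 / real r} ?w"
    using Henstock_Kurzweil_Integration.integral_combine[of 0 "1 / real r" pi ?w] r0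
      integrable_continuous_real[OF continuous_on_arc_density[OF assms(3)]]
    by simp
  \<comment> \<open>The exponent \<open>3/2\<close> arises because \<open>|1 - z|\<close> grows like \<open>sqrt \<alpha> * t\<close> along the circle.\<close>
  have p: "?p = \<alpha> powr (2 * real r - real n + 3 / 2) * sqrt \<alpha>"
    using assms(3) by (simp add: powr_half_sqrt[symmetric] powr_add[symmetric] algebra_simps)
  have "\<bar>kappa n r - exp (- harm r)\<bar> \<le> ?c * integral {0..pi} ?w"
    by (rule kappa_bound_by_arc_integral[OF assms(3,2)])
  also have "\<dots> = ?c * integral {1 / real r..pi} ?w + ?c * integral {0..1 / real r} ?w"
    by (simp only: split distrib_left)
  also have "\<dots> \<le> ?c * (pi\<^sup>2 * exp 4 / (4 * sqrt \<alpha> * (\<alpha> - 1)\<^sup>2) * ?S)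
      + ?c * (exp (1 - harm r - ?A) / (real r * (\<alpha> - 1) ^ 3))"
    using assms(3) by (intro add_mono mult_left_mono integral_far integral_near assms(1,3)) auto
  also have "?c * (pi\<^sup>2 * exp 4 / (4 * sqrt \<alpha> * (\<alpha> - 1)\<^sup>2) * ?S) =
      pi * exp 4 * \<alpha> powr (2 * real r - real n + 3 / 2) / ((real n)\<^sup>2 * (\<alpha> - 1)\<^sup>2) * ?S"
    unfolding p using assms(3) n0 by (simp add: power2_eq_square) (simp only: mult_ac)
  also have "exp (1 - harm r - ?A) = exp 1 * exp (- ?A - harm r)"
    by (simp add: algebra_simps flip: exp_add)
  also have "?c * (exp 1 * exp (- ?A - harm r) / (real r * (\<alpha> - 1) ^ 3)) =
      4 * exp 1 * ?p / (pi * (real n)\<^sup>2 * real r * (\<alpha> - 1) ^ 3) * exp (- ?A - harm r)"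
    by (simp only: times_divide_eq_left times_divide_eq_right divide_divide_eq_left mult_ac)
  finally show ?thesis .
qed

end
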